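(* Every $x$-torsion-free finite dimensional simple left $H$-module is isomorphic to $V_x(\rho,\lambda,\mu)$ for some $\lambda,\mu\in\mathbb{K}$ with $\lambda\neq0$, and $\rho\in\widehat{G}$.
   Context: $\mathbb{K}$ is an algebraically closed field of characteristic zero, $G$ is a finitely generated abelian group, $\widehat{G}$ is the group of homomorphisms $G\to\mathbb{K}^\times$, $\chi\in\widehat{G}$ has finite order $n$, and $b,c\in G$ satisfy $\chi(b)=\chi(c)$ and $bc\neq1$. Put $e=c^{-1}-b\in\mathbb{K}[G]$. $H=H(G,\chi,\chi^{-1},b,c,1)$ is (after replacing its second Ore variable $y$ by $c^{-1}y$) the algebra generated by $G,x,y$ subject to the relations of $G$ and $xg=\chi(g)gx$, $yg=\chi(g)^{-1}gy$ $(g\in G)$, $yx=xy+e$; it has $\mathbb{K}$-basis $\{gx^iy^j\mid g\in G,\ i,j\ge 0\}$. Let $\sigma:\mathbb{K}[G]\to\mathbb{K}[G]$ be the automorphism with $\sigma(g)=\chi(g)g$, and for $u\in\mathbb{K}[G]$ let $[u]_i^\sigma=\sum_{k=0}^{i-1}\sigma^{-k}(u)$ for $i\ge1$, $[u]_0^\sigma=0$. Characters $\rho\in\widehat{G}$ are extended to algebra maps $\rho:\mathbb{K}[G]\to\mathbb{K}$. For $\rho\in\widehat{G}$ and $\lambda,\mu\in\mathbb{K}$ with $\lambda\ne0$, $V_x(\rho,\lambda,\mu)$ is the $n$-dimensional $H$-module with basis $\{v_0,\ldots,v_{n-1}\}$ and action: $x\cdot v_i=v_{i+1}$ for $0\le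 i\le n-2$, $x\cdot v_{n-1}=\lambda v_0$; $y\cdot v_0=\lambda^{-1}\mu v_{n-1}$, $y\cdot v_i=(\mu+\rho([e]_i^\sigma))v_{i-1}$ for $1\le i\le n-1$; $g\cdot v_i=\rho(\sigma^{-i}(g))v_i$ for $g\in G$ and $0\le i\le n-1$. A module is $x$-torsion-free if none of its nonzero elements is killed by a power $x^k$, $k\ge1$. *)

theory Defs
  imports
    "HOL-Library.Poly_Mapping"
    "HOL-Computational_Algebra.Group_Closure"
    "HOL-Algebra.Algebraic_Closure_Type"
    "HOL-Algebra.Module"
begin

section \<open>Left modules over a not necessarily commutative ring\<close>

text \<open>The library locale \<open>module\<close> requires a commutative ring of scalars. As there, the fields
  \<open>mult\<close> and \<open>one\<close> of a module record are irrelevant.\<close>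

locale left_module = R?: ring R + M?: abelian_group M
  for R :: "('r, 'z) ring_scheme" and M :: "('r, 'm, 'w) module_scheme" +
  assumes smult_closed:
      "\<lbrakk> a \<in> carrier R; x \<in> carrier M \<rbrakk> \<Longrightarrow> a \<odot>\<^bsub>M\<^esub> x \<in> carrier M"
    and smult_l_distr:
      "\<lbrakk> a \<in> carrier R; b \<in> carrier R; x \<in> carrier M \<rbrakk> \<Longrightarrow>
        (a \<oplus>\<^bsub>R\<^esub> b) \<odot>\<^bsub>M\<^esub> x = (a \<odot>\<^bsub>M\<^esub> x) \<oplus>\<^bsub>M\<^esub> (b \<odot>\<^bsub>M\<^esub> x)"
    and smult_r_distr:
      "\<lbrakk> a \<in> carrier R; x \<in> carrier M; y \<in> carrier M \<rbrakk> \<Longrightarrow>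
        a \<odot>\<^bsub>M\<^esub> (x \<oplus>\<^bsub>M\<^esub> y) = (a \<odot>\<^bsub>M\<^esub> x) \<oplus>\<^bsub>M\<^esub> (a \<odot>\<^bsub>M\<^esub> y)"
    and smult_assoc:
      "\<lbrakk> a \<in> carrier R; b \<in> carrier R; x \<in> carrier M \<rbrakk> \<Longrightarrow>
        (a \<otimes>\<^bsub>R\<^esub> b) \<odot>\<^bsub>M\<^esub> x = a \<odot>\<^bsub>M\<^esub> (b \<odot>\<^bsub>M\<^esub> x)"
    and smult_one:
      "x \<in> carrier M \<Longrightarrow> \<one>\<^bsub>R\<^esub> \<odot>\<^bsub>M\<^esub> x = x"

definition simple_left_module ::
    "('r, 'z) ring_scheme \<Rightarrow> ('r, 'm, 'w) module_scheme \<Rightarrow> bool" where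
  "simple_left_module R M \<longleftrightarrow>
     left_module R M \<and> carrier M \<noteq> {\<zero>\<^bsub>M\<^esub>} \<and>
     (\<forall>N. submodule N R M \<longrightarrow> N = {\<zero>\<^bsub>M\<^esub>} \<or> N = carrier M)"

definition isomorphic_left_modules ::
    "('r, 'z) ring_scheme \<Rightarrow> ('r, 'm, 'w) module_scheme \<Rightarrow> ('r, 'l, 'v) module_scheme \<Rightarrow> bool" where
  "isomorphic_left_modules R M N \<longleftrightarrow>
     left_module R M \<and> left_module R N \<and>
     (\<exists>\<phi>. bij_betw \<phi> (carrier M) (carrier N) \<and>
        (\<forall>u\<in>carrier M. \<forall>w\<in>carrier M. \<phi> (u \<oplus>\<^bsub>M\<^esub> w) = \<phi> u \<oplus>\<^bsub>N\<^esub> \<phi> w) \<and>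
        (\<forall>a\<in>carrier R. \<forall>u\<in>carrier M. \<phi> (a \<odot>\<^bsub>M\<^esub> u) = a \<odot>\<^bsub>N\<^esub> \<phi> u))"

text \<open>For a module over an algebra with structure map \<open>\<iota>\<close> from the ground field.\<close>

definition finite_dimensional ::
    "('k \<Rightarrow> 'r) \<Rightarrow> ('r, 'm, 'w) module_scheme \<Rightarrow> bool" where
  "finite_dimensional \<iota> M \<longleftrightarrow>
     (\<exists>B. finite B \<and> B \<subseteq> carrier M \<and>
        (\<forall>m\<in>carrier M. \<exists>a. m = (\<Oplus>\<^bsub>M\<^esub>v\<in>B. \<iota> (a v) \<odot>\<^bsub>M\<^esub> v)))"

definition torsion_free_at ::
    "('r, 'z) ring_scheme \<Rightarrow> 'r \<Rightarrow> ('r, 'm, 'w) module_scheme \<Rightarrow> bool" where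
  "torsion_free_at R x M \<longleftrightarrow>
     (\<forall>m\<in>carrier M. m \<noteq> \<zero>\<^bsub>M\<^esub> \<longrightarrow>
        (\<forall>k::nat. k \<ge> 1 \<longrightarrow> (x [^]\<^bsub>R\<^esub> k) \<odot>\<^bsub>M\<^esub> m \<noteq> \<zero>\<^bsub>M\<^esub>))"


section \<open>Characters and the group algebra\<close>

text \<open>The abelian group \<open>G\<close> is a type of class \<open>ab_group_add\<close>, hence written additively:
  \<open>b + c\<close>, \<open>- c\<close>, \<open>0\<close> stand for \<open>bc\<close>, \<open>c\<^sup>-\<^sup>1\<close>, \<open>1\<close>. Its group algebra is then the
  convolution algebra \<open>'g \<Rightarrow>\<^sub>0 'k\<close>, in which \<open>Poly_Mapping.single g 1\<close> is the group element \<open>g\<close>.\<close>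

definition finitely_generated_group :: "'g::ab_group_add itself \<Rightarrow> bool" where
  "finitely_generated_group _ \<longleftrightarrow> (\<exists>S::'g set. finite S \<and> group_closure S = UNIV)"

definition character :: "('g::ab_group_add \<Rightarrow> 'k::field) \<Rightarrow> bool" where
  "character \<rho> \<longleftrightarrow> (\<forall>g. \<rho> g \<noteq> 0) \<and> (\<forall>g h. \<rho> (g + h) = \<rho> g * \<rho> h)"

definition character_has_order :: "('g::ab_group_add \<Rightarrow> 'k::field) \<Rightarrow> nat \<Rightarrow> bool" where
  "character_has_order \<chi> n \<longleftrightarrow>
     n > 0 \<and> (\<forall>g. \<chi> g ^ n = 1) \<and> (\<forall>m. 0 < m \<and> m < n \<longrightarrow> (\<exists>g. \<chi> g ^ m \<noteq> 1))"

definition extend_character :: "('g \<Rightarrow> 'k::field) \<Rightarrow> ('g \<Rightarrow>\<^sub>0 'k) \<Rightarrow> 'k" where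
  "extend_character \<rho> u = (\<Sum>g\<in>Poly_Mapping.keys u. Poly_Mapping.lookup u g * \<rho> g)"

definition sigma :: "('g \<Rightarrow> 'k::field) \<Rightarrow> ('g \<Rightarrow>\<^sub>0 'k) \<Rightarrow> ('g \<Rightarrow>\<^sub>0 'k)" where
  "sigma \<chi> = Poly_Mapping.mapp (\<lambda>g a. \<chi> g * a)"

definition sigma_inv_pow :: "('g \<Rightarrow> 'k::field) \<Rightarrow> nat \<Rightarrow> ('g \<Rightarrow>\<^sub>0 'k) \<Rightarrow> ('g \<Rightarrow>\<^sub>0 'k)" where
  "sigma_inv_pow \<chi> k = inv_into UNIV (sigma \<chi>) ^^ k"

definition sigma_bracket :: "('g \<Rightarrow> 'k::field) \<Rightarrow> ('g \<Rightarrow>\<^sub>0 'k) \<Rightarrow> nat \<Rightarrow> ('g \<Rightarrow>\<^sub>0 'k)" where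
  "sigma_bracket \<chi> u i = (\<Sum>k<i. sigma_inv_pow \<chi> k u)"

definition e_elem :: "'g::ab_group_add \<Rightarrow> 'g \<Rightarrow> ('g \<Rightarrow>\<^sub>0 'k::field)" where
  "e_elem b c = Poly_Mapping.single (- c) 1 - Poly_Mapping.single b 1"


section \<open>The algebra \<open>H\<close>, by generators and relations\<close>

text \<open>The free algebra on a set of letters is the monoid algebra of the free monoid of words,
  written additively so that convolution of finitely supported functions applies.\<close>

datatype 'a free_word = Word (letters: "'a list")

instantiation free_word :: (type) monoid_add
begin

definition zero_free_word :: "'a free_word" where
  "0 = Word []"

definition plus_free_word :: "'a free_word \<Rightarrow> 'a free_word \<Rightarrow> 'a free_word" where
  "v + w = Word (letters v @ letters w)"

instance
  by standard (auto simp: zero_free_word_def plus_free_word_def)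

end

type_synonym ('a, 'k) free_algebra = "'a free_word \<Rightarrow>\<^sub>0 'k"

definition free_const :: "'k::field \<Rightarrow> ('a, 'k) free_algebra" where
  "free_const k = Poly_Mapping.single 0 k"

definition free_gen :: "'a \<Rightarrow> ('a, 'k::field) free_algebra" where
  "free_gen l = Poly_Mapping.single (Word [l]) 1"

datatype 'g generator = GenG 'g | GenX | GenY

inductive_set H_relators ::
    "('g::ab_group_add \<Rightarrow> 'k::field) \<Rightarrow> 'g \<Rightarrow> 'g \<Rightarrow> ('g generator, 'k) free_algebra set"
  for \<chi> b c where
  grp_one: "free_gen (GenG 0) - 1 \<in> H_relators \<chi> b c"
| grp_mult: "free_gen (GenG (g + h)) - free_gen (GenG g) * free_gen (GenG h) \<in> H_relators \<chi> b c"
| x_grp: "free_gen GenX * free_gen (GenG g)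
          - free_const (\<chi> g) * free_gen (GenG g) * free_gen GenX \<in> H_relators \<chi> b c"
| y_grp: "free_gen GenY * free_gen (GenG g)
          - free_const (inverse (\<chi> g)) * free_gen (GenG g) * free_gen GenY \<in> H_relators \<chi> b c"
| y_x: "free_gen GenY * free_gen GenX
        - (free_gen GenX * free_gen GenY + (free_gen (GenG (- c)) - free_gen (GenG b)))
          \<in> H_relators \<chi> b c"

definition H_ideal ::
    "('g::ab_group_add \<Rightarrow> 'k::field) \<Rightarrow> 'g \<Rightarrow> 'g \<Rightarrow> ('g generator, 'k) free_algebra set" where
  "H_ideal \<chi> b c = Idl\<^bsub>ring_of_type_algebra\<^esub> (H_relators \<chi> b c)"

definition H_alg ::
    "('g::ab_group_add \<Rightarrow> 'k::field) \<Rightarrow> 'g \<Rightarrow> 'g \<Rightarrow> ('g generator, 'k) free_algebra set ring" where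
  "H_alg \<chi> b c = ring_of_type_algebra Quot H_ideal \<chi> b c"

definition H_class ::
    "('g::ab_group_add \<Rightarrow> 'k::field) \<Rightarrow> 'g \<Rightarrow> 'g \<Rightarrow>
     ('g generator, 'k) free_algebra \<Rightarrow> ('g generator, 'k) free_algebra set" where
  "H_class \<chi> b c p = H_ideal \<chi> b c +>\<^bsub>ring_of_type_algebra\<^esub> p"

definition H_scalar ::
    "('g::ab_group_add \<Rightarrow> 'k::field) \<Rightarrow> 'g \<Rightarrow> 'g \<Rightarrow> 'k \<Rightarrow> ('g generator, 'k) free_algebra set" where
  "H_scalar \<chi> b c k = H_class \<chi> b c (free_const k)"

definition H_x ::
    "('g::ab_group_add \<Rightarrow> 'k::field) \<Rightarrow> 'g \<Rightarrow> 'g \<Rightarrow> ('g generator, 'k) free_algebra set" where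
  "H_x \<chi> b c = H_class \<chi> b c (free_gen GenX)"


section \<open>The modules \<open>V\<^sub>x(\<rho>, \<lambda>, \<mu>)\<close>\<close>

text \<open>The underlying space consists of the coordinate functions \<open>f :: nat \<Rightarrow> 'k\<close> vanishing from
  \<open>n\<close> on, and \<open>basis_vec i\<close> is \<open>v\<^sub>i\<close>.\<close>

definition basis_vec :: "nat \<Rightarrow> nat \<Rightarrow> 'k::field" where
  "basis_vec i = (\<lambda>j. if j = i then 1 else 0)"

fun Vx_on_basis ::
    "('g::ab_group_add \<Rightarrow> 'k::field) \<Rightarrow> 'g \<Rightarrow> 'g \<Rightarrow> nat \<Rightarrow> ('g \<Rightarrow> 'k) \<Rightarrow> 'k \<Rightarrow> 'k \<Rightarrow>
     'g generator \<Rightarrow> nat \<Rightarrow> (nat \<Rightarrow> 'k)" where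
  "Vx_on_basis \<chi> b c n \<rho> lam mu GenX i =
     (if i + 1 < n then basis_vec (i + 1) else (\<lambda>j. lam * basis_vec 0 j))"
| "Vx_on_basis \<chi> b c n \<rho> lam mu GenY i =
     (if i = 0 then (\<lambda>j. inverse lam * mu * basis_vec (n - 1) j)
      else (\<lambda>j. (mu + extend_character \<rho> (sigma_bracket \<chi> (e_elem b c) i)) * basis_vec (i - 1) j))"
| "Vx_on_basis \<chi> b c n \<rho> lam mu (GenG g) i =
     (\<lambda>j. extend_character \<rho> (sigma_inv_pow \<chi> i (Poly_Mapping.single g 1)) * basis_vec i j)"

definition Vx_gen ::
    "('g::ab_group_add \<Rightarrow> 'k::field) \<Rightarrow> 'g \<Rightarrow> 'g \<Rightarrow> nat \<Rightarrow> ('g \<Rightarrow> 'k) \<Rightarrow> 'k \<Rightarrow> 'k \<Rightarrow>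
     'g generator \<Rightarrow> (nat \<Rightarrow> 'k) \<Rightarrow> (nat \<Rightarrow> 'k)" where
  "Vx_gen \<chi> b c n \<rho> lam mu l f = (\<lambda>j. \<Sum>i<n. f i * Vx_on_basis \<chi> b c n \<rho> lam mu l i j)"

definition free_action ::
    "('a \<Rightarrow> (nat \<Rightarrow> 'k) \<Rightarrow> (nat \<Rightarrow> 'k)) \<Rightarrow> ('a, 'k::field) free_algebra \<Rightarrow>
     (nat \<Rightarrow> 'k) \<Rightarrow> (nat \<Rightarrow> 'k)" where
  "free_action T p f =
     (\<lambda>j. \<Sum>w\<in>Poly_Mapping.keys p. Poly_Mapping.lookup p w * foldr T (letters w) f j)"

text \<open>A class \<open>h\<close> in \<open>H\<close> acts as any of its representatives. If for some vector the result
  depends on the representative, then every class sends that vector to one and the same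
  unspecified value, and the structure is not a left module (\<open>1\<close> and \<open>0\<close> would act on the vector
  in the same way, yet it is not zero). So being a left \<open>H\<close>-module, which is part of
  \<open>isomorphic_left_modules\<close>, forces the formulas for the generators to respect the relations.\<close>

definition V_x ::
    "('g::ab_group_add \<Rightarrow> 'k::field) \<Rightarrow> 'g \<Rightarrow> 'g \<Rightarrow> nat \<Rightarrow> ('g \<Rightarrow> 'k) \<Rightarrow> 'k \<Rightarrow> 'k \<Rightarrow>
     (('g generator, 'k) free_algebra set, nat \<Rightarrow> 'k) module" where
  "V_x \<chi> b c n \<rho> lam mu =
     \<lparr> carrier = {f. \<forall>i\<ge>n. f i = 0},
       monoid.mult = undefined,
       one = undefined,
       ring.zero = (\<lambda>_. 0),
       add = (\<lambda>f f' i. f i + f' i),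
       module.smult = (\<lambda>h f. THE w. \<forall>p\<in>h. free_action (Vx_gen \<chi> b c n \<rho> lam mu) p f = w) \<rparr>"

end

theory Submission
  imports Defs
begin

text \<open>Let \<open>M\<close> be a finite-dimensional simple module on which \<open>x\<close> acts injectively. The elements of
  \<open>G\<close> commute with each other and with \<open>x y\<close>, and \<open>G\<close> is generated by finitely many of them, so there
  is a common eigenvector \<open>m\<close>, on which \<open>G\<close> acts through a character \<open>\<rho>\<close>
  (\<open>weight_exists\<close>). The element \<open>x\<^sup>n\<close> preserves the weight space of \<open>\<rho>\<close>, because \<open>\<chi>\<^sup>n = 1\<close>, and moving
  \<open>x y\<close> past it produces the scalar \<open>\<rho>([e]\<^sub>n)\<close> (\<open>XY_X_power\<close>). This scalar is zero: otherwise the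
  vectors \<open>x\<^sup>n\<^sup>k m\<close> would be eigenvectors of \<open>x y\<close> for infinitely many eigenvalues
  (\<open>bracket_order_eq_zero\<close>). Hence \<open>x\<^sup>n\<close> and \<open>x y\<close> commute on the weight space and have a common
  eigenvector \<open>v\<close> there, with eigenvalues \<open>\<lambda> \<noteq> 0\<close> and \<open>\<mu>\<close> (\<open>generating_vector_exists\<close>).

  The vectors \<open>x\<^sup>i v\<close> with \<open>i < n\<close> have the pairwise different weights \<open>\<rho> \<chi>\<^sup>-\<^sup>i\<close>, so they are independent
  (\<open>X_powers_independent\<close>). The generators act on them by the formulas that define \<open>V\<^sub>x(\<rho>, \<lambda>, \<mu>)\<close>
  (\<open>comb_Vx_on_basis\<close>); for \<open>y\<close> one multiplies the claimed equation by \<open>x\<close>, which is injective, and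
  uses the known action of \<open>x y\<close>. Their span is therefore a nonzero submodule, which is \<open>M\<close> by
  simplicity, and the coordinate map \<open>V\<^sub>x(\<rho>, \<lambda>, \<mu>) \<rightarrow> M\<close> is bijective. That \<open>V\<^sub>x(\<rho>, \<lambda>, \<mu>)\<close> is a module,
  which can fail for other parameters, is transported back from \<open>M\<close> along this map.\<close>

section \<open>Actions of an algebra on a finite-dimensional space\<close>

text \<open>The acting algebra is a whole type, so linear combinations of the vectors \<open>p i \<bullet> m\<close> can be
  written as \<open>(\<Sum>i. const (a i) * p i) \<bullet> m\<close>, with the sum formed in the algebra instead of in \<open>M\<close>.\<close>

locale algebra_action = abelian_group M for M :: "('m, 'z) ring_scheme" (structure) +
  fixes act :: "'f::ring_1 \<Rightarrow> 'm \<Rightarrow> 'm" (infixr "\<bullet>" 73)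
    and const :: "'k::field \<Rightarrow> 'f"
  assumes act_closed [simp]: "m \<in> carrier M \<Longrightarrow> p \<bullet> m \<in> carrier M"
    and act_add: "m \<in> carrier M \<Longrightarrow> (p + q) \<bullet> m = p \<bullet> m \<oplus> q \<bullet> m"
    and act_mult: "m \<in> carrier M \<Longrightarrow> (p * q) \<bullet> m = p \<bullet> q \<bullet> m"
    and act_one [simp]: "m \<in> carrier M \<Longrightarrow> 1 \<bullet> m = m"
    and act_distrib: "m \<in> carrier M \<Longrightarrow> m' \<in> carrier M \<Longrightarrow> p \<bullet> (m \<oplus> m') = p \<bullet> m \<oplus> p \<bullet> m'"
    and const_add: "const (a + b) = const a + const b"
    and const_mult: "const (a * b) = const a * const b"
    and const_one [simp]: "const 1 = 1"
    and const_commute: "const a * p = p * const a"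
begin

lemma const_zero [simp]: "const 0 = 0"
  using const_add[of 0 0] by simp

lemma const_uminus: "const (- a) = - const a"
  using const_add[of a "- a"] by (simp add: eq_neg_iff_add_eq_0 add.commute)

lemma const_diff: "const (a - b) = const a - const b"
  using const_add[of a "- b"] by (simp add: const_uminus)

lemma const_sum: "const (\<Sum>i\<in>I. a i) = (\<Sum>i\<in>I. const (a i))"
  by (induction I rule: infinite_finite_induct) (auto simp: const_add)

lemma act_zero [simp]: "m \<in> carrier M \<Longrightarrow> 0 \<bullet> m = \<zero>"
  using act_add[of m 0 0] by (simp add: add.l_cancel_one')

lemma act_zero_right [simp]: "p \<bullet> \<zero> = \<zero>"
  using act_distrib[of \<zero> \<zero> p] by (simp add: add.l_cancel_one')

lemma act_eq_iff_act_diff: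
  assumes "m \<in> carrier M"
  shows "p \<bullet> m = q \<bullet> m \<longleftrightarrow> (p - q) \<bullet> m = \<zero>"
  using act_add[OF assms, of "p - q" q] assms by (auto simp: add.r_cancel_one)

lemma act_const_eq_zero_iff:
  assumes "m \<in> carrier M"
  shows "const a \<bullet> m = \<zero> \<longleftrightarrow> a = 0 \<or> m = \<zero>"
proof -
  have "m = \<zero>" if "a \<noteq> 0" "const a \<bullet> m = \<zero>"
  proof -
    have "m = const (inverse a * a) \<bullet> m" using that assms by simp
    also have "\<dots> = \<zero>" using that assms by (simp only: const_mult act_mult act_zero_right)
    finally show ?thesis .
  qed
  then show ?thesis using assms by auto
qed

lemma act_const_inject:
  assumes "m \<in> carrier M" "m \<noteq> \<zero>" "const r \<bullet> m = const s \<bullet> m"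
  shows "r = s"
  using assms act_eq_iff_act_diff[of m "const r" "const s"]
  by (simp add: const_diff[symmetric] act_const_eq_zero_iff)

lemma act_sum_eq_zero:
  assumes "m \<in> carrier M" "\<And>i. i \<in> I \<Longrightarrow> p i \<bullet> m = \<zero>"
  shows "(\<Sum>i\<in>I. p i) \<bullet> m = \<zero>"
  using assms(2) by (induction I rule: infinite_finite_induct) (auto simp: act_add assms(1))

lemma act_sum_cong:
  assumes "m \<in> carrier M" "\<And>i. i \<in> I \<Longrightarrow> p i \<bullet> m = q i \<bullet> m"
  shows "(\<Sum>i\<in>I. p i) \<bullet> m = (\<Sum>i\<in>I. q i) \<bullet> m"
  using assms act_sum_eq_zero[of m I "\<lambda>i. p i - q i"]
  by (simp add: act_eq_iff_act_diff sum_subtractf)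

text \<open>The induction removes one vector after applying \<open>d - \<delta> d j\<close>, which kills the \<open>j\<close>-th vector
  and rescales the others; as \<open>D\<close> separates the vectors, every coefficient is reached.\<close>

lemma separated_eigenvectors_independent:
  assumes m: "m \<in> carrier M" and "finite I"
    and "\<And>i. i \<in> I \<Longrightarrow> p i \<bullet> m \<noteq> \<zero>"
    and "\<And>i d. i \<in> I \<Longrightarrow> d \<in> D \<Longrightarrow> (d * p i) \<bullet> m = (const (\<delta> d i) * p i) \<bullet> m"
    and "\<And>i j. i \<in> I \<Longrightarrow> j \<in> I \<Longrightarrow> i \<noteq> j \<Longrightarrow> \<exists>d\<in>D. \<delta> d i \<noteq> \<delta> d j"
    and "(\<Sum>i\<in>I. const (a i) * p i) \<bullet> m = \<zero>"
    and "i \<in> I"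
  shows "a i = 0"
  using assms(2-)
proof (induction I arbitrary: a i rule: finite_induct)
  case empty
  then show ?case by simp
next
  case (insert j I)
  let ?s = "\<lambda>a. \<Sum>i\<in>I. const (a i) * p i"
  have a0: "a i = 0" if i: "i \<in> I" for i
  proof -
    obtain d where d: "d \<in> D" "\<delta> d i \<noteq> \<delta> d j"
      using insert.prems(3)[of i j] i insert.hyps by auto
    let ?e = "d - const (\<delta> d j)"
    have e: "(?e * (const (a k) * p k)) \<bullet> m = (const (a k * (\<delta> d k - \<delta> d j)) * p k) \<bullet> m"
      if "k \<in> insert j I" for k
    proof -
      have "(?e * p k) \<bullet> m = (const (\<delta> d k - \<delta> d j) * p k) \<bullet> m"
        using insert.prems(2)[OF that d(1)] m
        by (simp add: act_eq_iff_act_diff const_diff algebra_simps)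
      then have "const (a k) \<bullet> (?e * p k) \<bullet> m = const (a k) \<bullet> (const (\<delta> d k - \<delta> d j) * p k) \<bullet> m"
        by simp
      moreover have "?e * (const (a k) * p k) = const (a k) * (?e * p k)"
        by (metis const_commute mult.assoc)
      ultimately show ?thesis using m
        by (simp add: act_mult const_mult)
    qed
    have "(\<Sum>k\<in>insert j I. const (a k * (\<delta> d k - \<delta> d j)) * p k) \<bullet> m
        = (\<Sum>k\<in>insert j I. ?e * (const (a k) * p k)) \<bullet> m"
      by (rule act_sum_cong[OF m]) (simp add: e)
    also have "\<dots> = ?e \<bullet> (\<Sum>k\<in>insert j I. const (a k) * p k) \<bullet> m"
      using m by (simp only: sum_distrib_left[symmetric] act_mult)
    also have "\<dots> = \<zero>" using insert.prems(4) by simp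
    finally have "(?s (\<lambda>k. a k * (\<delta> d k - \<delta> d j))) \<bullet> m = \<zero>"
      using insert.hyps by simp
    then have "a i * (\<delta> d i - \<delta> d j) = 0"
      using insert.prems i by (intro insert.IH) auto
    then show ?thesis using d by simp
  qed
  then have "?s a = 0" by simp
  then have "const (a j) \<bullet> p j \<bullet> m = \<zero>"
    using insert.prems(4) insert.hyps m by (simp add: act_mult)
  then have "a j = 0"
    using insert.prems(1)[of j] m by (simp add: act_const_eq_zero_iff)
  then show ?case using a0 insert.prems(5) by blast
qed

end

text \<open>Gaussian elimination: an equation with a nonzero coefficient at \<open>j\<close> is used to eliminate the
  unknown \<open>j\<close> from the others.\<close>

lemma underdetermined_system_solvable:
  fixes A :: "'i \<Rightarrow> 'v \<Rightarrow> 'k::field"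
  assumes "finite B" "finite I" "card B < card I"
  shows "\<exists>a. (\<exists>i\<in>I. a i \<noteq> 0) \<and> (\<forall>v\<in>B. (\<Sum>i\<in>I. a i * A i v) = 0)"
  using assms
proof (induction B arbitrary: I A rule: finite_induct)
  case empty
  then obtain i where "i \<in> I" by fastforce
  then show ?case by (intro exI[of _ "\<lambda>_. 1"]) auto
next
  case (insert v B)
  show ?case
  proof (cases "\<forall>i\<in>I. A i v = 0")
    case True
    have "card B < card I" using insert by simp
    with insert.IH[OF insert.prems(1)] obtain a where
      "\<exists>i\<in>I. a i \<noteq> 0" "\<forall>v\<in>B. (\<Sum>i\<in>I. a i * A i v) = 0" by blast
    with True show ?thesis by (intro exI[of _ a]) auto
  next
    case False
    then obtain j where j: "j \<in> I" "A j v \<noteq> 0" by blast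
    let ?J = "I - {j}"
    have "card B < card ?J" using insert j by simp
    with insert.IH[of ?J "\<lambda>i w. A i w - A i v / A j v * A j w"] insert.prems
    obtain a where a: "\<exists>i\<in>?J. a i \<noteq> 0"
      "\<And>w. w \<in> B \<Longrightarrow> (\<Sum>i\<in>?J. a i * (A i w - A i v / A j v * A j w)) = 0" by blast
    define s where "s = (\<Sum>i\<in>?J. a i * A i v / A j v)"
    let ?a = "a(j := - s)"
    have eq: "(\<Sum>i\<in>I. ?a i * A i w) = (\<Sum>i\<in>?J. a i * (A i w - A i v / A j v * A j w))" for w
    proof -
      have "(\<Sum>i\<in>I. ?a i * A i w) = - s * A j w + (\<Sum>i\<in>?J. ?a i * A i w)"
        using j insert.prems(1) by (subst sum.remove[of I j]) auto
      also have "(\<Sum>i\<in>?J. ?a i * A i w) = (\<Sum>i\<in>?J. a i * A i w)"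
        by (rule sum.cong) auto
      finally have "(\<Sum>i\<in>I. ?a i * A i w) = (\<Sum>i\<in>?J. a i * A i w) - s * A j w" by simp
      moreover have "s * A j w = (\<Sum>i\<in>?J. a i * (A i v / A j v * A j w))"
        unfolding s_def sum_distrib_right by (rule sum.cong) auto
      ultimately show ?thesis
        by (simp only: right_diff_distrib sum_subtractf)
    qed
    have "(\<Sum>i\<in>?J. a i * (A i v - A i v / A j v * A j v)) = 0" using j by simp
    then have "\<forall>w\<in>insert v B. (\<Sum>i\<in>I. ?a i * A i w) = 0" using a(2) eq by auto
    moreover have "\<exists>i\<in>I. ?a i \<noteq> 0" using a(1) by auto
    ultimately show ?thesis by blast
  qed
qed

locale finite_dimensional_action = algebra_action M act const
  for M :: "('m, 'z) ring_scheme" (structure)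
    and act :: "'f::ring_1 \<Rightarrow> 'm \<Rightarrow> 'm" (infixr "\<bullet>" 73)
    and const :: "'k::alg_closed_field \<Rightarrow> 'f" +
  assumes finite_span: "\<exists>B. finite B \<and> B \<subseteq> carrier M \<and>
        (\<forall>m\<in>carrier M. \<exists>a. m = (\<Oplus>v\<in>B. const (a v) \<bullet> v))"
begin

text \<open>Take for \<open>N\<close> the size of a spanning set: the coordinates of \<open>N + 1\<close> vectors give \<open>N\<close> equations
  for the \<open>N + 1\<close> coefficients.\<close>

lemma linear_dependency:
  obtains N :: nat where "\<And>p m. m \<in> carrier M \<Longrightarrow>
     \<exists>a. (\<exists>i\<le>N. a i \<noteq> 0) \<and> (\<Sum>i\<le>N. const (a i) * p i) \<bullet> m = \<zero>"
proof -
  obtain B where B: "finite B" "B \<subseteq> carrier M"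
    "\<And>m. m \<in> carrier M \<Longrightarrow> \<exists>a. m = (\<Oplus>v\<in>B. const (a v) \<bullet> v)"
    using finite_span by blast
  have closed: "(\<lambda>v. q v \<bullet> v) \<in> B \<rightarrow> carrier M" for q using B(2) by auto
  have finsum_distrib: "q \<bullet> (\<Oplus>v\<in>B'. const (a v) \<bullet> v) = (\<Oplus>v\<in>B'. q \<bullet> const (a v) \<bullet> v)"
    if "B' \<subseteq> B" for q a B'
  proof -
    from that have "finite B'" using B(1) finite_subset by blast
    then show ?thesis using that
    proof (induction B' rule: finite_induct)
      case (insert v B')
      moreover have "(\<lambda>v. const (a v) \<bullet> v) \<in> B' \<rightarrow> carrier M"
        "(\<lambda>v. q \<bullet> const (a v) \<bullet> v) \<in> B' \<rightarrow> carrier M"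
        using insert B(2) by auto
      ultimately show ?case using B(2) by (auto simp: finsum_insert act_distrib)
    qed simp
  qed
  have "\<exists>a. (\<exists>i\<le>card B. a i \<noteq> 0) \<and> (\<Sum>i\<le>card B. const (a i) * p i) \<bullet> m = \<zero>"
    if m: "m \<in> carrier M" for p m
  proof -
    have "\<forall>i. \<exists>a. p i \<bullet> m = (\<Oplus>v\<in>B. const (a v) \<bullet> v)" using B(3) m by simp
    then obtain A where A: "\<And>i. p i \<bullet> m = (\<Oplus>v\<in>B. const (A i v) \<bullet> v)" by metis
    have comb: "(\<Sum>i\<in>I. const (a i) * p i) \<bullet> m = (\<Oplus>v\<in>B. const (\<Sum>i\<in>I. a i * A i v) \<bullet> v)"
      if "finite I" for I a
      using that
    proof (induction I rule: finite_induct)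
      case empty
      have "(\<Oplus>v\<in>B. const 0 \<bullet> v) = (\<Oplus>v\<in>B. \<zero>)"
        using B(2) by (intro finsum_cong') auto
      then show ?case using m by simp
    next
      case (insert j I)
      have "(\<Sum>i\<in>insert j I. const (a i) * p i) \<bullet> m
          = const (a j) \<bullet> (\<Oplus>v\<in>B. const (A j v) \<bullet> v) \<oplus> (\<Oplus>v\<in>B. const (\<Sum>i\<in>I. a i * A i v) \<bullet> v)"
        using insert m A by (simp add: act_add act_mult)
      also have "\<dots> = (\<Oplus>v\<in>B. const (a j) \<bullet> const (A j v) \<bullet> v \<oplus> const (\<Sum>i\<in>I. a i * A i v) \<bullet> v)"
        using B(2) by (subst finsum_addf) (auto simp: finsum_distrib closed)
      also have "\<dots> = (\<Oplus>v\<in>B. const (\<Sum>i\<in>insert j I. a i * A i v) \<bullet> v)"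
        using B(2) insert.hyps
        by (intro finsum_cong') (auto simp: const_add const_mult act_add act_mult)
      finally show ?case .
    qed
    obtain a where a: "\<exists>i\<in>{..card B}. a i \<noteq> 0"
      "\<forall>v\<in>B. (\<Sum>i\<in>{..card B}. a i * A i v) = 0"
      using underdetermined_system_solvable[OF B(1), of "{..card B}" A] by auto
    have "(\<Oplus>v\<in>B. const (\<Sum>i\<le>card B. a i * A i v) \<bullet> v) = (\<Oplus>v\<in>B. \<zero>)"
      using B(2) a(2) by (intro finsum_cong') auto
    then show ?thesis using a(1) comb[of "{..card B}" a] by (intro exI[of _ a]) auto
  qed
  then show thesis using that by blast
qed

definition linear_subspace :: "'m set \<Rightarrow> bool" where
  "linear_subspace W \<longleftrightarrow> W \<subseteq> carrier M \<and>
     (\<forall>v\<in>W. \<forall>w\<in>W. v \<oplus> w \<in> W) \<and> (\<forall>a. \<forall>w\<in>W. const a \<bullet> w \<in> W)"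

text \<open>Horner evaluation at an element of an algebra that need not be commutative.\<close>

definition eval_poly :: "'f \<Rightarrow> 'k poly \<Rightarrow> 'f" where
  "eval_poly t p = fold_coeffs (\<lambda>a f. const a + t * f) p 0"

lemma eval_poly_0 [simp]: "eval_poly t 0 = 0"
  by (simp add: eval_poly_def)

lemma eval_poly_pCons [simp]: "eval_poly t (pCons a p) = const a + t * eval_poly t p"
  by (cases "p = 0 \<and> a = 0") (auto simp: eval_poly_def)

lemma eval_poly_add: "eval_poly t (p + q) = eval_poly t p + eval_poly t q"
  by (induction p q rule: poly_induct2) (simp_all add: const_add algebra_simps)

lemma eval_poly_smult: "eval_poly t (smult a p) = const a * eval_poly t p"
proof (induction p)
  case (pCons b p)
  have "t * (const a * f) = const a * (t * f)" for f
    by (metis const_commute mult.assoc)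
  with pCons show ?case by (simp add: const_mult distrib_left)
qed simp

lemma eval_poly_monom: "eval_poly t (monom a i) = const a * t ^ i"
proof (induction i)
  case (Suc i)
  have "t * (const a * t ^ i) = const a * t ^ Suc i"
    by (simp add: mult.assoc[symmetric] const_commute[of a t])
  with Suc show ?case by (simp add: monom_Suc)
qed (simp add: monom_0)

lemma eval_poly_sum: "eval_poly t (\<Sum>i\<in>I. p i) = (\<Sum>i\<in>I. eval_poly t (p i))"
  by (induction I rule: infinite_finite_induct) (auto simp: eval_poly_add)

lemma eval_poly_linear_factor:
  "eval_poly t ([:- r, 1:] * q) = (t - const r) * eval_poly t q"
proof -
  have "[:- r, 1:] * q = smult (- r) q + pCons 0 q" by simp
  then show ?thesis
    by (simp only: eval_poly_add eval_poly_smult eval_poly_pCons const_uminus) (simp add: algebra_simps)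
qed

lemma eval_poly_in_subspace:
  assumes "linear_subspace W" "\<And>w. w \<in> W \<Longrightarrow> t \<bullet> w \<in> W" "w \<in> W"
  shows "eval_poly t p \<bullet> w \<in> W"
proof -
  have w: "w \<in> carrier M" using assms by (auto simp: linear_subspace_def)
  show ?thesis
  proof (induction p)
    case 0
    have "const 0 \<bullet> w \<in> W" using assms unfolding linear_subspace_def by blast
    then show ?case by simp
  next
    case (pCons a p)
    then show ?case using assms w by (simp add: linear_subspace_def act_add act_mult)
  qed
qed

text \<open>The vectors \<open>t\<^sup>i m\<close> are dependent, so a nonzero polynomial in \<open>t\<close> kills a given nonzero
  vector. Splitting off its linear factors one at a time, the first one that turns a nonzero
  vector into zero exhibits an eigenvector.\<close>

lemma eigenvector_in_invariant_subspace:
  assumes W: "linear_subspace W" and inv: "\<And>w. w \<in> W \<Longrightarrow> t \<bullet> w \<in> W"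
    and m: "m \<in> W" "m \<noteq> \<zero>"
  shows "\<exists>w\<in>W. w \<noteq> \<zero> \<and> (\<exists>r. t \<bullet> w = const r \<bullet> w)"
proof -
  have mM: "m \<in> carrier M" using W m by (auto simp: linear_subspace_def)
  have split: "\<exists>w\<in>W. w \<noteq> \<zero> \<and> (\<exists>r. t \<bullet> w = const r \<bullet> w)"
    if "p \<noteq> 0" "eval_poly t p \<bullet> m = \<zero>" for p
    using that
  proof (induction "degree p" arbitrary: p)
    case 0
    then obtain a where "p = [:a:]" "a \<noteq> 0" by (metis degree_eq_zeroE pCons_0_0)
    then show ?case using 0 m mM by (simp add: act_const_eq_zero_iff)
  next
    case (Suc k)
    then obtain r where "poly p r = 0" using alg_closed_imp_poly_has_root[of p] by auto
    then obtain q where q: "p = [:- r, 1:] * q" by (metis poly_eq_0_iff_dvd dvdE)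
    with Suc.prems(1) have "q \<noteq> 0" by auto
    from q Suc.hyps(2) \<open>q \<noteq> 0\<close> have "k = degree q"
      by (simp add: degree_mult_eq del: mult_pCons_left)
    let ?w = "eval_poly t q \<bullet> m"
    have w: "?w \<in> W" "?w \<in> carrier M"
      using eval_poly_in_subspace[OF W inv m(1)] mM by auto
    have "(t - const r) \<bullet> ?w = \<zero>"
      using Suc.prems(2) mM unfolding q eval_poly_linear_factor by (simp add: act_mult)
    then have "t \<bullet> ?w = const r \<bullet> ?w"
      using w(2) by (simp add: act_eq_iff_act_diff)
    with Suc.hyps(1)[OF \<open>k = degree q\<close> \<open>q \<noteq> 0\<close>] w(1) show ?case by blast
  qed
  obtain N :: nat where N: "\<And>p m. m \<in> carrier M \<Longrightarrow>
     \<exists>a. (\<exists>i\<le>N. a i \<noteq> 0) \<and> (\<Sum>i\<le>N. const (a i) * p i) \<bullet> m = \<zero>"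
    using linear_dependency by blast
  obtain a where a: "\<exists>i\<le>N. a i \<noteq> 0" "(\<Sum>i\<le>N. const (a i) * t ^ i) \<bullet> m = \<zero>"
    using N[OF mM, of "\<lambda>i. t ^ i"] by blast
  let ?p = "\<Sum>i\<le>N. monom (a i) i"
  have "coeff ?p i = a i" if "i \<le> N" for i
    using that by (simp add: coeff_sum if_distrib sum.delta)
  then have "?p \<noteq> 0" using a(1) by (metis coeff_0)
  then show ?thesis
    using a(2) by (intro split[of ?p]) (simp_all add: eval_poly_sum eval_poly_monom)
qed

text \<open>The eigenspace of one operator is invariant under those that commute with it, so the operators
  can be treated one after the other. Commutation is asked for on \<open>W\<close> alone because \<open>x\<^sup>n\<close> and \<open>x y\<close>
  commute only on a weight space.\<close>

lemma common_eigenvector: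
  assumes "finite S" and "linear_subspace W" and "\<And>t w. t \<in> S \<Longrightarrow> w \<in> W \<Longrightarrow> t \<bullet> w \<in> W"
    and "\<And>s t w. s \<in> S \<Longrightarrow> t \<in> S \<Longrightarrow> w \<in> W \<Longrightarrow> s \<bullet> t \<bullet> w = t \<bullet> s \<bullet> w"
    and "m \<in> W" "m \<noteq> \<zero>"
  shows "\<exists>w\<in>W. w \<noteq> \<zero> \<and> (\<forall>t\<in>S. \<exists>r. t \<bullet> w = const r \<bullet> w)"
  using assms
proof (induction S arbitrary: W m rule: finite_induct)
  case empty
  show ?case using empty.prems(4,5) by auto
next
  case (insert s S)
  have sub: "W \<subseteq> carrier M" using insert.prems(1) by (simp add: linear_subspace_def)
  obtain r m' where m': "m' \<in> W" "m' \<noteq> \<zero>" "s \<bullet> m' = const r \<bullet> m'"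
    using eigenvector_in_invariant_subspace[OF insert.prems(1), of s m] insert.prems by auto
  define E where "E = {w \<in> W. s \<bullet> w = const r \<bullet> w}"
  have swap: "p \<bullet> const a \<bullet> w = const a \<bullet> p \<bullet> w" if "w \<in> W" for p a w
  proof -
    have "(p * const a) \<bullet> w = (const a * p) \<bullet> w" by (simp only: const_commute)
    then show ?thesis using that sub by (simp add: act_mult subset_iff)
  qed
  have "const a \<bullet> w \<in> E" if "w \<in> E" for a w
    using that insert.prems(1) swap[of w s a] swap[of w "const r" a]
    by (simp add: E_def linear_subspace_def)
  moreover have "v \<oplus> w \<in> E" if "v \<in> E" "w \<in> E" for v w
    using that insert.prems(1) sub by (simp add: E_def linear_subspace_def act_distrib subset_iff)
  ultimately have "linear_subspace E"
    using sub by (auto simp: linear_subspace_def E_def)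
  moreover have "t \<bullet> w \<in> E" if "t \<in> S" "w \<in> E" for t w
  proof -
    have "s \<bullet> t \<bullet> w = t \<bullet> s \<bullet> w" using insert.prems(3)[of s t w] that by (simp add: E_def)
    also have "\<dots> = const r \<bullet> t \<bullet> w" using that swap[of w t r] by (simp add: E_def)
    finally show ?thesis using insert.prems(2)[of t w] that by (simp add: E_def)
  qed
  moreover have "p \<bullet> q \<bullet> w = q \<bullet> p \<bullet> w" if "p \<in> S" "q \<in> S" "w \<in> E" for p q w
    using insert.prems(3)[of p q w] that by (simp add: E_def)
  moreover have "m' \<in> E" using m' by (simp add: E_def)
  ultimately obtain w where "w \<in> E" "w \<noteq> \<zero>" "\<forall>t\<in>S. \<exists>r. t \<bullet> w = const r \<bullet> w"
    using insert.IH[of E m'] m'(2) by blast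
  then have "w \<in> W" "\<forall>t\<in>insert s S. \<exists>r. t \<bullet> w = const r \<bullet> w"
    unfolding E_def by blast+
  with \<open>w \<noteq> \<zero>\<close> show ?case by blast
qed

end

section \<open>Values of characters on the group algebra\<close>

lemma extend_character_superset:
  assumes "finite A" "Poly_Mapping.keys u \<subseteq> A"
  shows "extend_character \<rho> u = (\<Sum>g\<in>A. Poly_Mapping.lookup u g * \<rho> g)"
  unfolding extend_character_def
  using assms by (intro sum.mono_neutral_left) (auto simp: in_keys_iff)

lemma extend_character_add:
  "extend_character \<rho> (u + v) = extend_character \<rho> u + extend_character \<rho> v"
proof -
  let ?A = "Poly_Mapping.keys u \<union> Poly_Mapping.keys v"
  show ?thesis
    using Poly_Mapping.keys_add[of u v]
    by (simp add: extend_character_superset[of ?A] lookup_add distrib_right sum.distrib)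
qed

lemma extend_character_zero [simp]: "extend_character \<rho> 0 = 0"
  by (simp add: extend_character_def)

lemma extend_character_diff:
  "extend_character \<rho> (u - v) = extend_character \<rho> u - extend_character \<rho> v"
  using extend_character_add[of \<rho> "u - v" v] by simp

lemma extend_character_sum:
  "extend_character \<rho> (\<Sum>i\<in>I. u i) = (\<Sum>i\<in>I. extend_character \<rho> (u i))"
  by (induction I rule: infinite_finite_induct) (auto simp: extend_character_add)

lemma extend_character_single [simp]:
  "extend_character \<rho> (Poly_Mapping.single g a) = a * \<rho> g"
  by (simp add: extend_character_superset[of "{g}"])

text \<open>\<open>\<sigma>\<close> rescales the coefficient of \<open>g\<close> by \<open>\<chi> g \<noteq> 0\<close>, so it is invertible, and its inverse divides
  that coefficient by \<open>\<chi> g\<close>.\<close>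

lemma lookup_inv_sigma:
  assumes "\<And>g. \<chi> g \<noteq> 0"
  shows "Poly_Mapping.lookup (inv_into UNIV (sigma \<chi>) u) g = inverse (\<chi> g) * Poly_Mapping.lookup u g"
proof -
  have lookup: "Poly_Mapping.lookup (Poly_Mapping.mapp (\<lambda>g a. f g * a) w) h
      = f h * Poly_Mapping.lookup w h" for f :: "'a \<Rightarrow> 'b" and w h
    by (simp add: lookup_mapp when_def in_keys_iff)
  let ?w = "Poly_Mapping.mapp (\<lambda>g a. inverse (\<chi> g) * a) u"
  have "inj (sigma \<chi>)"
    using assms by (auto intro!: injI poly_mapping_eqI simp: sigma_def poly_mapping_eq_iff fun_eq_iff lookup)
  moreover have "sigma \<chi> ?w = u"
    using assms by (intro poly_mapping_eqI) (simp add: sigma_def lookup)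
  ultimately have "inv_into UNIV (sigma \<chi>) u = ?w" by (metis inv_f_f)
  then show ?thesis by (simp add: lookup)
qed

lemma lookup_sigma_inv_pow:
  assumes "\<And>g. \<chi> g \<noteq> 0"
  shows "Poly_Mapping.lookup (sigma_inv_pow \<chi> k u) g = inverse (\<chi> g) ^ k * Poly_Mapping.lookup u g"
  by (induction k) (simp_all add: sigma_inv_pow_def lookup_inv_sigma[OF assms])

lemma extend_character_sigma_inv_pow_single:
  assumes "\<And>g. \<chi> g \<noteq> 0"
  shows "extend_character \<rho> (sigma_inv_pow \<chi> k (Poly_Mapping.single g 1)) = inverse (\<chi> g) ^ k * \<rho> g"
proof -
  have "sigma_inv_pow \<chi> k (Poly_Mapping.single g 1) = Poly_Mapping.single g (inverse (\<chi> g) ^ k)"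
    by (rule poly_mapping_eqI) (auto simp: lookup_sigma_inv_pow[OF assms] lookup_single when_def)
  then show ?thesis by simp
qed

lemma extend_character_sigma_bracket:
  assumes "\<And>g. \<chi> g \<noteq> 0"
  shows "extend_character \<rho> (sigma_bracket \<chi> (e_elem b c) k)
    = (\<Sum>j<k. inverse (\<chi> (- c)) ^ j * \<rho> (- c) - inverse (\<chi> b) ^ j * \<rho> b)"
proof -
  have "sigma_inv_pow \<chi> j (e_elem b c)
      = Poly_Mapping.single (- c) (inverse (\<chi> (- c)) ^ j) - Poly_Mapping.single b (inverse (\<chi> b) ^ j)" for j
    by (rule poly_mapping_eqI)
      (auto simp: lookup_sigma_inv_pow[OF assms] e_elem_def lookup_single lookup_minus when_def)
  then show ?thesis
    by (simp add: sigma_bracket_def extend_character_sum extend_character_diff)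
qed

section \<open>Weight vectors\<close>

text \<open>A finite-dimensional representation of \<open>H\<close> given by operators that satisfy the defining
  relations, with \<open>x\<close> acting injectively. Injectivity of \<open>x\<close> is the same as being \<open>x\<close>-torsion-free.\<close>

locale H_representation = finite_dimensional_action M act const
  for M :: "('m, 'z) ring_scheme" (structure)
    and act :: "'f::ring_1 \<Rightarrow> 'm \<Rightarrow> 'm" (infixr "\<bullet>" 73)
    and const :: "'k::{alg_closed_field, field_char_0} \<Rightarrow> 'f" +
  fixes \<chi> :: "'g::ab_group_add \<Rightarrow> 'k" and b c :: 'g and G :: "'g \<Rightarrow> 'f" and x y :: 'f
  assumes char: "character \<chi>"
    and G_zero: "m \<in> carrier M \<Longrightarrow> G 0 \<bullet> m = m"
    and G_add: "m \<in> carrier M \<Longrightarrow> G (g + h) \<bullet> m = G g \<bullet> G h \<bullet> m"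
    and X_G: "m \<in> carrier M \<Longrightarrow> x \<bullet> G g \<bullet> m = const (\<chi> g) \<bullet> G g \<bullet> x \<bullet> m"
    and Y_G: "m \<in> carrier M \<Longrightarrow> y \<bullet> G g \<bullet> m = const (inverse (\<chi> g)) \<bullet> G g \<bullet> y \<bullet> m"
    and Y_X: "m \<in> carrier M \<Longrightarrow> y \<bullet> x \<bullet> m = x \<bullet> y \<bullet> m \<oplus> (G (- c) - G b) \<bullet> m"
    and X_torsion_free: "m \<in> carrier M \<Longrightarrow> x \<bullet> m = \<zero> \<Longrightarrow> m = \<zero>"
begin

lemma char_nonzero [simp]: "\<chi> g \<noteq> 0"
  using char by (simp add: character_def)

definition weight_space :: "('g \<Rightarrow> 'k) \<Rightarrow> 'm set" where
  "weight_space \<rho> = {m \<in> carrier M. \<forall>g. G g \<bullet> m = const (\<rho> g) \<bullet> m}"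

abbreviation bracket :: "('g \<Rightarrow> 'k) \<Rightarrow> nat \<Rightarrow> 'k" where
  "bracket \<rho> k \<equiv> extend_character \<rho> (sigma_bracket \<chi> (e_elem b c) k)"

lemma weight_space_closed: "m \<in> weight_space \<rho> \<Longrightarrow> m \<in> carrier M"
  by (simp add: weight_space_def)

lemma weight_spaceD: "m \<in> weight_space \<rho> \<Longrightarrow> G g \<bullet> m = const (\<rho> g) \<bullet> m"
  by (simp add: weight_space_def)

lemma act_const_swap: "m \<in> carrier M \<Longrightarrow> p \<bullet> const a \<bullet> m = const a \<bullet> p \<bullet> m"
  using act_mult[of m p "const a"] act_mult[of m "const a" p] by (simp add: const_commute[of a p])

lemma act_const_const: "m \<in> carrier M \<Longrightarrow> const a \<bullet> const a' \<bullet> m = const (a * a') \<bullet> m"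
  by (simp add: const_mult act_mult)

lemma subspace_weight_space: "linear_subspace (weight_space \<rho>)"
proof -
  have "const a \<bullet> m \<in> weight_space \<rho>" if "m \<in> weight_space \<rho>" for a m
    using that act_const_swap[of m _ a] act_const_swap[of m "const a"]
    by (auto simp: weight_space_def act_const_const mult.commute)
  moreover have "m \<oplus> m' \<in> weight_space \<rho>" if "m \<in> weight_space \<rho>" "m' \<in> weight_space \<rho>" for m m'
    using that by (auto simp: weight_space_def act_distrib)
  ultimately show ?thesis by (auto simp: linear_subspace_def weight_space_def)
qed

lemma X_weight:
  assumes "m \<in> weight_space \<rho>"
  shows "x \<bullet> m \<in> weight_space (\<lambda>g. inverse (\<chi> g) * \<rho> g)"
proof -
  have m: "m \<in> carrier M" using assms by (rule weight_space_closed)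
  have "G g \<bullet> x \<bullet> m = const (inverse (\<chi> g) * \<rho> g) \<bullet> x \<bullet> m" for g
  proof -
    have "G g \<bullet> x \<bullet> m = const (inverse (\<chi> g)) \<bullet> const (\<chi> g) \<bullet> G g \<bullet> x \<bullet> m"
      using m by (simp add: act_const_const)
    also have "\<dots> = const (inverse (\<chi> g)) \<bullet> x \<bullet> const (\<rho> g) \<bullet> m"
      using m weight_spaceD[OF assms] by (simp add: X_G[symmetric])
    also have "\<dots> = const (inverse (\<chi> g) * \<rho> g) \<bullet> x \<bullet> m"
      using m by (simp add: act_const_swap[of m x] act_const_const)
    finally show ?thesis .
  qed
  then show ?thesis using m by (simp add: weight_space_def)
qed

lemma X_power_weight:
  assumes "m \<in> weight_space \<rho>"
  shows "x ^ k \<bullet> m \<in> weight_space (\<lambda>g. inverse (\<chi> g) ^ k * \<rho> g)"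
proof (induction k)
  case 0
  then show ?case using assms weight_space_closed by simp
next
  case (Suc k)
  then show ?case
    using X_weight[OF Suc] weight_space_closed[OF assms] by (simp add: act_mult mult.assoc)
qed

lemma X_power_torsion_free:
  "m \<in> carrier M \<Longrightarrow> x ^ k \<bullet> m = \<zero> \<Longrightarrow> m = \<zero>"
  by (induction k) (auto simp: act_mult dest: X_torsion_free[rotated])

lemma XY_G_commute:
  assumes "m \<in> carrier M"
  shows "(x * y) \<bullet> G g \<bullet> m = G g \<bullet> (x * y) \<bullet> m"
  using assms by (simp add: act_mult Y_G X_G act_const_swap[of _ x] act_const_const)

lemma XY_weight: "m \<in> weight_space \<rho> \<Longrightarrow> (x * y) \<bullet> m \<in> weight_space \<rho>"
  using XY_G_commute[of m, symmetric] by (auto simp: weight_space_def act_const_swap[of m "x * y"])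

text \<open>If \<open>m\<close> has weight \<open>\<rho>\<close>, then \<open>x\<^sup>j m\<close> has weight \<open>\<rho> \<chi>\<^sup>-\<^sup>j\<close>, and \<open>e\<close> acts on it as the scalar
  \<open>\<rho>(\<sigma>\<^sup>-\<^sup>j(e))\<close>. Each step of moving \<open>x y\<close> past \<open>x\<close> adds one of these scalars, and their sum is
  \<open>\<rho>([e]\<^sub>k)\<close>.\<close>

lemma XY_X_power:
  assumes "m \<in> weight_space \<rho>"
  shows "(x * y) \<bullet> x ^ k \<bullet> m = x ^ k \<bullet> (x * y) \<bullet> m \<oplus> const (bracket \<rho> k) \<bullet> x ^ k \<bullet> m"
proof (induction k)
  case 0
  have "bracket \<rho> 0 = 0" by (simp add: extend_character_sigma_bracket)
  then show ?case using weight_space_closed[OF assms] by simp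
next
  case (Suc k)
  have m: "m \<in> carrier M" using assms by (rule weight_space_closed)
  let ?w = "x ^ k \<bullet> m"
  define r where "r = inverse (\<chi> (- c)) ^ k * \<rho> (- c) - inverse (\<chi> b) ^ k * \<rho> b"
  have w: "?w \<in> carrier M" using m by simp
  have "(G (- c) - G b) \<bullet> ?w = const r \<bullet> ?w"
  proof -
    have "G g \<bullet> ?w = const (inverse (\<chi> g) ^ k * \<rho> g) \<bullet> ?w" for g
      using weight_spaceD[OF X_power_weight[OF assms]] .
    moreover have "(p - q) \<bullet> ?w = (p' - q') \<bullet> ?w" if "p \<bullet> ?w = p' \<bullet> ?w" "q \<bullet> ?w = q' \<bullet> ?w" for p q p' q'
    proof -
      have "((p - p') - (q - q')) \<bullet> ?w = \<zero>"
        using that act_eq_iff_act_diff[OF w, of "p - p'" "q - q'"] w by (simp add: act_eq_iff_act_diff)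
      then show ?thesis by (simp add: act_eq_iff_act_diff[OF w] algebra_simps)
    qed
    ultimately show ?thesis unfolding r_def const_diff by blast
  qed
  then have YX: "y \<bullet> x \<bullet> ?w = (x * y) \<bullet> ?w \<oplus> const r \<bullet> ?w"
    using Y_X[OF w] w by (simp add: act_mult)
  have "(x * y) \<bullet> x ^ Suc k \<bullet> m = x \<bullet> y \<bullet> x \<bullet> ?w" using m by (simp add: act_mult)
  also have "\<dots> = x \<bullet> (x ^ k \<bullet> (x * y) \<bullet> m \<oplus> const (bracket \<rho> k) \<bullet> ?w \<oplus> const r \<bullet> ?w)"
    by (simp only: YX Suc.IH)
  also have "\<dots> = x ^ Suc k \<bullet> (x * y) \<bullet> m \<oplus> (const (bracket \<rho> k) \<bullet> x \<bullet> ?w \<oplus> const r \<bullet> x \<bullet> ?w)"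
    using m w by (simp add: act_distrib act_mult a_assoc act_const_swap[of _ x])
  also have "const (bracket \<rho> k) \<bullet> x \<bullet> ?w \<oplus> const r \<bullet> x \<bullet> ?w = const (bracket \<rho> (Suc k)) \<bullet> x ^ Suc k \<bullet> m"
    using m by (simp add: act_mult act_add const_add extend_character_sigma_bracket r_def)
  finally show ?case .
qed

text \<open>A common eigenvector of a finite set of generators of \<open>G\<close> is one of all of \<open>G\<close>, and its
  eigenvalues form a character because \<open>G\<close> acts by a homomorphism.\<close>

lemma weight_exists:
  assumes fg: "finitely_generated_group TYPE('g)" and "carrier M \<noteq> {\<zero>}"
  shows "\<exists>\<rho> m. character \<rho> \<and> m \<in> weight_space \<rho> \<and> m \<noteq> \<zero> \<and> (\<exists>r. (x * y) \<bullet> m = const r \<bullet> m)"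
proof -
  obtain S :: "'g set" where S: "finite S" "group_closure S = UNIV"
    using fg by (auto simp: finitely_generated_group_def)
  obtain m0 where m0: "m0 \<in> carrier M" "m0 \<noteq> \<zero>" using assms(2) zero_closed by blast
  have "linear_subspace (carrier M)" by (simp add: linear_subspace_def)
  moreover have "G g \<bullet> G h \<bullet> w = G h \<bullet> G g \<bullet> w" if "w \<in> carrier M" for g h w
    using that G_add[of w g h] G_add[of w h g] by (simp add: add.commute)
  moreover from this have "s \<bullet> t \<bullet> w = t \<bullet> s \<bullet> w"
    if "s \<in> insert (x * y) (G ` S)" "t \<in> insert (x * y) (G ` S)" "w \<in> carrier M" for s t w
    using that XY_G_commute[of w] by auto
  ultimately have "\<exists>m\<in>carrier M. m \<noteq> \<zero> \<and> (\<forall>t\<in>insert (x * y) (G ` S). \<exists>r. t \<bullet> m = const r \<bullet> m)"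
    using m0 S(1) by (intro common_eigenvector[of _ _ m0]) simp_all
  then obtain m where m: "m \<in> carrier M" "m \<noteq> \<zero>"
    and eig: "\<forall>t\<in>insert (x * y) (G ` S). \<exists>r. t \<bullet> m = const r \<bullet> m" by blast
  have scalar: "\<exists>r. G g \<bullet> m = const r \<bullet> m" if "g \<in> group_closure S" for g
    using that
  proof (induction rule: group_closure.induct)
    case (base g)
    then show ?case using eig G_zero[OF m(1)] m(1) by (metis act_one const_one image_eqI insertCI insertE)
  next
    case (diff g h)
    then obtain r s where rs: "G g \<bullet> m = const r \<bullet> m" "G h \<bullet> m = const s \<bullet> m" by blast
    \<comment> \<open>The eigenvalue \<open>s\<close> of \<open>h\<close> is nonzero because \<open>h\<close> is invertible.\<close>
    have h: "m = G (- h) \<bullet> G h \<bullet> m"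
      using G_add[of m "- h" h] G_zero m by simp
    have s: "const s \<bullet> G (- h) \<bullet> m = m"
      using h m unfolding rs(2) by (simp add: act_const_swap[of m "G (- h)"])
    have "s \<noteq> 0" using s m by auto
    then have "G (- h) \<bullet> m = const (inverse s) \<bullet> const s \<bullet> G (- h) \<bullet> m"
      using m by (simp add: act_const_const)
    then have "G (- h) \<bullet> m = const (inverse s) \<bullet> m" using s by simp
    then have "G (g - h) \<bullet> m = const (inverse s * r) \<bullet> m"
      using G_add[of m g "- h"] m rs(1) by (simp add: act_const_swap[of m "G g"] act_const_const)
    then show ?case by blast
  qed
  then obtain \<rho> where \<rho>: "\<And>g. G g \<bullet> m = const (\<rho> g) \<bullet> m" using S(2) by (metis UNIV_I)
  note unique = act_const_inject[OF m]
  have add: "\<rho> (g + h) = \<rho> g * \<rho> h" for g h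
  proof (rule unique)
    have "const (\<rho> (g + h)) \<bullet> m = G g \<bullet> const (\<rho> h) \<bullet> m" using G_add[OF m(1), of g h] \<rho> by simp
    then show "const (\<rho> (g + h)) \<bullet> m = const (\<rho> g * \<rho> h) \<bullet> m"
      using m \<rho> by (simp add: act_const_swap[of m "G g"] act_const_const mult.commute)
  qed
  have "\<rho> 0 = 1" using \<rho>[of 0] G_zero m by (intro unique) simp
  then have "\<rho> g * \<rho> (- g) = 1" for g using add[of g "- g"] by simp
  then have "\<rho> g \<noteq> 0" for g by (metis mult_zero_left zero_neq_one)
  with add have "character \<rho>" by (simp add: character_def)
  then show ?thesis using m \<rho> eig by (auto simp: weight_space_def)
qed

text \<open>If \<open>\<rho>([e]\<^sub>n)\<close> were nonzero, the vectors \<open>x\<^sup>n\<^sup>k m\<close> would be eigenvectors of \<open>x y\<close> with the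
  eigenvalues \<open>r + k \<rho>([e]\<^sub>n)\<close>. These are pairwise different in characteristic zero, so the vectors
  would be independent, against finite dimension.\<close>

lemma bracket_order_eq_zero:
  assumes n: "\<And>g. \<chi> g ^ n = 1"
    and m: "m \<in> weight_space \<rho>" "m \<noteq> \<zero>" "(x * y) \<bullet> m = const r \<bullet> m"
  shows "bracket \<rho> n = 0"
proof (rule ccontr)
  assume nz: "bracket \<rho> n \<noteq> 0"
  have mM: "m \<in> carrier M" using m weight_space_closed by blast
  let ?z = "x ^ n"
  have closed: "?z \<bullet> w \<in> weight_space \<rho>" if "w \<in> weight_space \<rho>" for w
    using X_power_weight[OF that, of n] n by (simp add: power_inverse)
  have w: "?z ^ k \<bullet> m \<in> weight_space \<rho>" for k
    using closed by (induction k) (auto simp: act_mult m mM)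
  have eig: "(x * y) \<bullet> ?z ^ k \<bullet> m = const (r + of_nat k * bracket \<rho> n) \<bullet> ?z ^ k \<bullet> m" for k
  proof (induction k)
    case 0
    then show ?case using m mM by simp
  next
    case (Suc k)
    let ?w = "?z ^ k \<bullet> m"
    have wM: "?w \<in> carrier M" using mM by simp
    have "(x * y) \<bullet> ?z ^ Suc k \<bullet> m = (x * y) \<bullet> ?z \<bullet> ?w" using mM by (simp add: act_mult)
    also have "\<dots> = ?z \<bullet> (x * y) \<bullet> ?w \<oplus> const (bracket \<rho> n) \<bullet> ?z \<bullet> ?w"
      by (rule XY_X_power[OF w])
    also have "\<dots> = const (r + of_nat k * bracket \<rho> n) \<bullet> ?z \<bullet> ?w \<oplus> const (bracket \<rho> n) \<bullet> ?z \<bullet> ?w"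
      using Suc wM by (simp add: act_const_swap[of _ ?z])
    also have "\<dots> = const (r + of_nat k * bracket \<rho> n + bracket \<rho> n) \<bullet> ?z ^ Suc k \<bullet> m"
      using mM wM by (simp add: act_add const_add act_mult)
    finally show ?case by (simp add: algebra_simps)
  qed
  obtain N :: nat where N: "\<And>p m. m \<in> carrier M \<Longrightarrow>
     \<exists>a. (\<exists>i\<le>N. a i \<noteq> 0) \<and> (\<Sum>i\<le>N. const (a i) * p i) \<bullet> m = \<zero>"
    using linear_dependency by blast
  obtain a i where a: "i \<le> N" "a i \<noteq> 0" "(\<Sum>i\<le>N. const (a i) * ?z ^ i) \<bullet> m = \<zero>"
    using N[OF mM, of "\<lambda>i. ?z ^ i"] by blast
  have "a i = 0"
  proof (rule separated_eigenvectors_independent[OF mM, of "{..N}" "\<lambda>i. ?z ^ i" "{x * y}"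
        "\<lambda>_ k. r + of_nat k * bracket \<rho> n"])
    show "?z ^ k \<bullet> m \<noteq> \<zero>" for k
      using X_power_torsion_free[OF mM, of "n * k"] m(2) by (auto simp: power_mult)
    show "(d * ?z ^ k) \<bullet> m = (const (r + of_nat k * bracket \<rho> n) * ?z ^ k) \<bullet> m"
      if "d \<in> {x * y}" for d k
      using eig[of k] that mM by (simp add: act_mult[of m])
  qed (use a nz in auto)
  with a show False by simp
qed

text \<open>Since \<open>\<rho>([e]\<^sub>n) = 0\<close>, the operators \<open>x\<^sup>n\<close> and \<open>x y\<close> commute on the weight space of \<open>\<rho>\<close>, where they
  consequently have a common eigenvector.\<close>

lemma generating_vector_exists:
  assumes "finitely_generated_group TYPE('g)" "carrier M \<noteq> {\<zero>}" and n: "\<And>g. \<chi> g ^ n = 1"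
  shows "\<exists>\<rho> lam mu v. character \<rho> \<and> lam \<noteq> 0 \<and> v \<in> weight_space \<rho> \<and> v \<noteq> \<zero> \<and>
    x ^ n \<bullet> v = const lam \<bullet> v \<and> (x * y) \<bullet> v = const mu \<bullet> v"
proof -
  obtain \<rho> m r where \<rho>: "character \<rho>" and m: "m \<in> weight_space \<rho>" "m \<noteq> \<zero>" "(x * y) \<bullet> m = const r \<bullet> m"
    using weight_exists[OF assms(1,2)] by blast
  have "bracket \<rho> n = 0" by (rule bracket_order_eq_zero[OF n m])
  then have comm: "(x * y) \<bullet> x ^ n \<bullet> w = x ^ n \<bullet> (x * y) \<bullet> w" if "w \<in> weight_space \<rho>" for w
    using XY_X_power[OF that, of n] weight_space_closed[OF that] by simp
  have inv: "x ^ n \<bullet> w \<in> weight_space \<rho>" if "w \<in> weight_space \<rho>" for w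
    using X_power_weight[OF that, of n] n by (simp add: power_inverse)
  have "\<exists>v\<in>weight_space \<rho>. v \<noteq> \<zero> \<and> (\<forall>t\<in>{x ^ n, x * y}. \<exists>r. t \<bullet> v = const r \<bullet> v)"
  proof (rule common_eigenvector[OF _ subspace_weight_space])
    show "t \<bullet> w \<in> weight_space \<rho>" if "t \<in> {x ^ n, x * y}" "w \<in> weight_space \<rho>" for t w
      using that inv XY_weight by blast
    show "s \<bullet> t \<bullet> w = t \<bullet> s \<bullet> w" if "s \<in> {x ^ n, x * y}" "t \<in> {x ^ n, x * y}" "w \<in> weight_space \<rho>" for s t w
      using that(1,2) comm[OF that(3)] by auto
  qed (use m in auto)
  then obtain v lam mu where v: "v \<in> weight_space \<rho>" "v \<noteq> \<zero>"
    "x ^ n \<bullet> v = const lam \<bullet> v" "(x * y) \<bullet> v = const mu \<bullet> v" by blast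
  have "v \<in> carrier M" using v(1) by (rule weight_space_closed)
  then have "lam \<noteq> 0" using v(2,3) X_power_torsion_free[of v n] by auto
  with \<rho> v show ?thesis by blast
qed

lemma X_cancel:
  assumes "m \<in> carrier M" "x \<bullet> p \<bullet> m = x \<bullet> q \<bullet> m"
  shows "p \<bullet> m = q \<bullet> m"
proof -
  have "x \<bullet> (p - q) \<bullet> m = \<zero>"
    using assms act_eq_iff_act_diff[OF assms(1), of "x * p" "x * q"]
    by (simp add: act_mult right_diff_distrib[symmetric])
  then show ?thesis using assms X_torsion_free act_eq_iff_act_diff by simp
qed

lemma Y_generating_vector:
  assumes "v \<in> carrier M" "lam \<noteq> 0" "0 < n" "x ^ n \<bullet> v = const lam \<bullet> v" "(x * y) \<bullet> v = const mu \<bullet> v"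
  shows "y \<bullet> v = (const (inverse lam * mu) * x ^ (n - 1)) \<bullet> v"
proof (rule X_cancel)
  have "x \<bullet> x ^ (n - 1) \<bullet> v = const lam \<bullet> v"
    using assms by (metis act_mult power_minus_mult power_commutes)
  then show "x \<bullet> y \<bullet> v = x \<bullet> (const (inverse lam * mu) * x ^ (n - 1)) \<bullet> v"
    using assms by (simp add: act_mult act_const_swap[of _ x] act_const_const mult.commute[of _ lam] mult.assoc[symmetric])
qed fact

lemma Y_X_power:
  assumes "v \<in> weight_space \<rho>" "(x * y) \<bullet> v = const mu \<bullet> v"
  shows "(y * x ^ Suc i) \<bullet> v = (const (mu + bracket \<rho> (Suc i)) * x ^ i) \<bullet> v"
proof (rule X_cancel)
  show v: "v \<in> carrier M" using assms weight_space_closed by blast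
  have "x \<bullet> (y * x ^ Suc i) \<bullet> v = (x * y) \<bullet> x ^ Suc i \<bullet> v" using v by (simp add: act_mult)
  also have "\<dots> = const mu \<bullet> x ^ Suc i \<bullet> v \<oplus> const (bracket \<rho> (Suc i)) \<bullet> x ^ Suc i \<bullet> v"
    using v assms(2) by (simp only: XY_X_power[OF assms(1)] act_const_swap[OF v])
  also have "\<dots> = const (mu + bracket \<rho> (Suc i)) \<bullet> x ^ Suc i \<bullet> v"
    using v by (simp add: const_add act_add)
  finally show "x \<bullet> (y * x ^ Suc i) \<bullet> v = x \<bullet> (const (mu + bracket \<rho> (Suc i)) * x ^ i) \<bullet> v"
    using v by (simp add: act_mult act_const_swap[of _ x])
qed

text \<open>The vectors \<open>x\<^sup>i v\<close> have the weights \<open>\<rho> \<chi>\<^sup>-\<^sup>i\<close>, which some \<open>g\<close> tells apart when \<open>i < n\<close>, as \<open>\<chi>\<close> has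
  order exactly \<open>n\<close>.\<close>

lemma X_powers_independent:
  assumes \<rho>: "character \<rho>" and v: "v \<in> weight_space \<rho>" "v \<noteq> \<zero>" and n: "character_has_order \<chi> n"
    and "(\<Sum>i<n. const (a i) * x ^ i) \<bullet> v = \<zero>" "i < n"
  shows "a i = 0"
  \<comment> \<open>The operators are elements of the algebra and need not determine \<open>g\<close>, so their eigenvalues are
    chosen by \<open>SOME\<close>; \<open>\<delta>\<close> below identifies them.\<close>
proof (rule separated_eigenvectors_independent[of v "{..<n}" "\<lambda>i. x ^ i" "range G"
      "\<lambda>d i. SOME r. (d * x ^ i) \<bullet> v = (const r * x ^ i) \<bullet> v"])
  let ?\<delta> = "\<lambda>d i. SOME r. (d * x ^ i) \<bullet> v = (const r * x ^ i) \<bullet> v"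
  show vM: "v \<in> carrier M" using v weight_space_closed by blast
  show nz: "x ^ k \<bullet> v \<noteq> \<zero>" for k using X_power_torsion_free v vM by blast
  have eig: "(G g * x ^ k) \<bullet> v = (const (inverse (\<chi> g) ^ k * \<rho> g) * x ^ k) \<bullet> v" for g k
    using weight_spaceD[OF X_power_weight[OF v(1)]] vM by (simp add: act_mult)
  have \<delta>: "?\<delta> (G g) k = inverse (\<chi> g) ^ k * \<rho> g" for g k
  proof (rule some_equality)
    fix r assume "(G g * x ^ k) \<bullet> v = (const r * x ^ k) \<bullet> v"
    then have "const r \<bullet> x ^ k \<bullet> v = const (inverse (\<chi> g) ^ k * \<rho> g) \<bullet> x ^ k \<bullet> v"
      using eig[of g k] vM by (simp add: act_mult)
    then show "r = inverse (\<chi> g) ^ k * \<rho> g" using nz[of k] vM by (intro act_const_inject[of "x ^ k \<bullet> v"]) simp_all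
  qed (rule eig)
  show "(d * x ^ k) \<bullet> v = (const (?\<delta> d k) * x ^ k) \<bullet> v" if "d \<in> range G" for d k
    using that eig \<delta> by auto
  have sep: "\<exists>g. inverse (\<chi> g) ^ k * \<rho> g \<noteq> inverse (\<chi> g) ^ j * \<rho> g" if "j < k" "k < n" for j k
  proof -
    have "0 < k - j" "k - j < n" using that by auto
    then obtain g where g: "\<chi> g ^ (k - j) \<noteq> 1" using n unfolding character_has_order_def by blast
    have "\<chi> g ^ k = \<chi> g ^ j * \<chi> g ^ (k - j)" using that by (simp add: power_add[symmetric])
    with g have "\<chi> g ^ k \<noteq> \<chi> g ^ j" by simp
    then show ?thesis using \<rho> by (intro exI[of _ g]) (simp add: character_def power_inverse)
  qed
  show "\<exists>d\<in>range G. ?\<delta> d k \<noteq> ?\<delta> d j" if k: "k \<in> {..<n}" "j \<in> {..<n}" "k \<noteq> j" for k j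
  proof -
    obtain g where "inverse (\<chi> g) ^ k * \<rho> g \<noteq> inverse (\<chi> g) ^ j * \<rho> g"
      using sep[of k j] sep[of j k] k by (metis lessThan_iff linorder_neqE_nat)
    then show ?thesis by (intro bexI[of _ "G g"]) (simp_all add: \<delta>)
  qed
qed (use assms in auto)

end

section \<open>The coordinate map into the module\<close>

locale H_generating_vector = H_representation M act const \<chi> b c G x y
  for M :: "('m, 'z) ring_scheme" (structure)
    and act :: "'f::ring_1 \<Rightarrow> 'm \<Rightarrow> 'm" (infixr "\<bullet>" 73)
    and const :: "'k::{alg_closed_field, field_char_0} \<Rightarrow> 'f"
    and \<chi> :: "'g::ab_group_add \<Rightarrow> 'k" and b c :: 'g and G :: "'g \<Rightarrow> 'f" and x y :: 'f +
  fixes n :: nat and \<rho> :: "'g \<Rightarrow> 'k" and lam mu :: 'k and v :: 'm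
  assumes order: "character_has_order \<chi> n"
    and rho: "character \<rho>"
    and lam: "lam \<noteq> 0"
    and v_weight: "v \<in> weight_space \<rho>"
    and v_nonzero: "v \<noteq> \<zero>"
    and v_lam: "x ^ n \<bullet> v = const lam \<bullet> v"
    and v_mu: "(x * y) \<bullet> v = const mu \<bullet> v"
begin

definition gen :: "'g generator \<Rightarrow> 'f" where
  "gen l = (case l of GenG g \<Rightarrow> G g | GenX \<Rightarrow> x | GenY \<Rightarrow> y)"

text \<open>\<open>comb f \<bullet> v\<close> is the vector of the module with the coordinates \<open>f\<close> in the basis \<open>x\<^sup>i v\<close>.\<close>

definition comb :: "(nat \<Rightarrow> 'k) \<Rightarrow> 'f" where
  "comb f = (\<Sum>i<n. const (f i) * x ^ i)"

lemma n_pos: "0 < n"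
  using order by (simp add: character_has_order_def)

lemma v_closed [simp]: "v \<in> carrier M"
  using v_weight by (rule weight_space_closed)

lemma comb_linear: "comb (\<lambda>j. \<Sum>i\<in>I. f i * h i j) = (\<Sum>i\<in>I. const (f i) * comb (h i))"
proof -
  have "comb (\<lambda>j. \<Sum>i\<in>I. f i * h i j) = (\<Sum>j<n. \<Sum>i\<in>I. const (f i) * (const (h i j) * x ^ j))"
    by (simp add: comb_def const_sum const_mult sum_distrib_right mult.assoc)
  also have "\<dots> = (\<Sum>i\<in>I. const (f i) * comb (h i))"
    by (subst sum.swap) (simp add: comb_def sum_distrib_left)
  finally show ?thesis .
qed

lemma comb_scaled_basis_vec:
  assumes "k < n"
  shows "comb (\<lambda>j. a * basis_vec k j) = const a * x ^ k"
proof -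
  have "comb (\<lambda>j. a * basis_vec k j) = (\<Sum>j<n. if j = k then const a * x ^ k else 0)"
    unfolding comb_def by (rule sum.cong) (auto simp: basis_vec_def)
  also have "\<dots> = const a * x ^ k" using assms by simp
  finally show ?thesis .
qed

lemma comb_basis_vec: "k < n \<Longrightarrow> comb (basis_vec k) = x ^ k"
  using comb_scaled_basis_vec[of k 1] by simp

text \<open>The formulas that define \<open>V\<^sub>x\<close> are the ones that \<open>G\<close>, \<open>x\<close> and \<open>y\<close> obey on the vectors \<open>x\<^sup>i v\<close>.\<close>

lemma comb_Vx_on_basis:
  assumes "i < n"
  shows "comb (Vx_on_basis \<chi> b c n \<rho> lam mu l i) \<bullet> v = (gen l * x ^ i) \<bullet> v"
proof (cases l)
  case (GenG g)
  then show ?thesis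
    using assms weight_spaceD[OF X_power_weight[OF v_weight]]
    by (simp add: gen_def comb_scaled_basis_vec extend_character_sigma_inv_pow_single act_mult)
next
  case GenX
  show ?thesis
  proof (cases "i + 1 < n")
    case True
    then show ?thesis using GenX by (simp add: gen_def comb_basis_vec)
  next
    case False
    with assms have "x ^ n = x * x ^ i" by (metis Suc_eq_plus1 Suc_lessI power_Suc)
    then show ?thesis
      using GenX False v_lam comb_scaled_basis_vec[OF n_pos, of lam] by (simp add: gen_def)
  qed
next
  case GenY
  show ?thesis
  proof (cases i)
    case 0
    then show ?thesis
      using GenY n_pos Y_generating_vector[OF v_closed lam n_pos v_lam v_mu]
      by (simp add: gen_def comb_scaled_basis_vec)
  next
    case (Suc k)
    then show ?thesis
      using GenY assms Y_X_power[OF v_weight v_mu, of k]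
      by (simp add: gen_def comb_scaled_basis_vec)
  qed
qed

lemma comb_Vx_gen:
  "comb (Vx_gen \<chi> b c n \<rho> lam mu l f) \<bullet> v = gen l \<bullet> comb f \<bullet> v"
proof -
  have "comb (Vx_gen \<chi> b c n \<rho> lam mu l f) \<bullet> v
      = (\<Sum>i<n. const (f i) * comb (Vx_on_basis \<chi> b c n \<rho> lam mu l i)) \<bullet> v"
    unfolding Vx_gen_def by (simp only: comb_linear)
  also have "\<dots> = (\<Sum>i<n. gen l * (const (f i) * x ^ i)) \<bullet> v"
  proof (rule act_sum_cong)
    fix i assume "i \<in> {..<n}"
    then have "(const (f i) * comb (Vx_on_basis \<chi> b c n \<rho> lam mu l i)) \<bullet> v
        = (const (f i) * (gen l * x ^ i)) \<bullet> v"
      by (simp add: act_mult[of v "const (f i)"] comb_Vx_on_basis)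
    also have "const (f i) * (gen l * x ^ i) = gen l * (const (f i) * x ^ i)"
      by (metis const_commute mult.assoc)
    finally show "(const (f i) * comb (Vx_on_basis \<chi> b c n \<rho> lam mu l i)) \<bullet> v
        = (gen l * (const (f i) * x ^ i)) \<bullet> v" .
  qed simp
  also have "\<dots> = gen l \<bullet> comb f \<bullet> v"
    by (simp add: sum_distrib_left[symmetric] comb_def[symmetric] act_mult)
  finally show ?thesis .
qed

lemma comb_injective:
  assumes "comb f \<bullet> v = comb f' \<bullet> v" "i < n"
  shows "f i = f' i"
proof -
  have "(\<Sum>i<n. const (f i - f' i) * x ^ i) \<bullet> v = \<zero>"
    using assms(1) by (simp add: act_eq_iff_act_diff comb_def const_diff left_diff_distrib sum_subtractf)
  then show ?thesis
    using X_powers_independent[OF rho v_weight v_nonzero order, of "\<lambda>i. f i - f' i" i] assms(2) by simp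
qed

end

section \<open>The algebra \<open>H\<close> and its modules\<close>

lemma ring_of_type_algebra_ring: "ring (ring_of_type_algebra :: 'a::ring_1 ring)"
proof -
  have "\<exists>y. x + y = 0" for x :: 'a using right_minus by blast
  then show ?thesis
    unfolding ring_of_type_algebra_def by unfold_locales (auto simp: algebra_simps Units_def add_eq_0_iff)
qed

lemma ring_of_type_algebra_simps [simp]:
  "carrier ring_of_type_algebra = UNIV"
  "p \<otimes>\<^bsub>ring_of_type_algebra\<^esub> q = p * q" "\<one>\<^bsub>ring_of_type_algebra\<^esub> = 1"
  "p \<oplus>\<^bsub>ring_of_type_algebra\<^esub> q = p + q" "\<zero>\<^bsub>ring_of_type_algebra\<^esub> = 0"
  by (simp_all add: ring_of_type_algebra_def)

lemma ring_of_type_algebra_minus [simp]: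
  "p \<ominus>\<^bsub>ring_of_type_algebra\<^esub> q = p - (q :: 'a::ring_1)"
proof -
  interpret ring "ring_of_type_algebra :: 'a ring" by (rule ring_of_type_algebra_ring)
  have "\<ominus>\<^bsub>ring_of_type_algebra\<^esub> q = - q" by (rule minus_equality) simp_all
  then show ?thesis by (simp add: a_minus_def)
qed

context
  fixes \<chi> :: "'g::ab_group_add \<Rightarrow> 'k::field" and b c :: 'g
begin

lemma H_ideal_ideal: "ideal (H_ideal \<chi> b c) ring_of_type_algebra"
  unfolding H_ideal_def by (rule ring.genideal_ideal[OF ring_of_type_algebra_ring]) simp

lemma H_class_ring_hom: "H_class \<chi> b c \<in> ring_hom ring_of_type_algebra (H_alg \<chi> b c)"
  using ideal.rcos_ring_hom[OF H_ideal_ideal]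
  by (simp add: H_class_def[abs_def] H_alg_def)

lemma carrier_H_alg: "carrier (H_alg \<chi> b c) = range (H_class \<chi> b c)"
  by (auto simp: H_alg_def H_class_def FactRing_def A_RCOSETS_def')

lemma H_class_closed [simp]: "H_class \<chi> b c p \<in> carrier (H_alg \<chi> b c)"
  by (simp add: carrier_H_alg)

lemma H_class_hom_simps:
  "H_class \<chi> b c (p + q) = H_class \<chi> b c p \<oplus>\<^bsub>H_alg \<chi> b c\<^esub> H_class \<chi> b c q"
  "H_class \<chi> b c (p * q) = H_class \<chi> b c p \<otimes>\<^bsub>H_alg \<chi> b c\<^esub> H_class \<chi> b c q"
  "H_class \<chi> b c 1 = \<one>\<^bsub>H_alg \<chi> b c\<^esub>"
  using ring_hom_add[OF H_class_ring_hom, of p q] ring_hom_mult[OF H_class_ring_hom, of p q]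
    ring_hom_one[OF H_class_ring_hom] by simp_all

lemma H_class_self: "p \<in> H_class \<chi> b c p"
proof -
  interpret ideal "H_ideal \<chi> b c" ring_of_type_algebra by (rule H_ideal_ideal)
  show ?thesis by (simp add: H_class_def a_rcos_self)
qed

lemma H_class_eqI: "q \<in> H_class \<chi> b c p \<Longrightarrow> H_class \<chi> b c q = H_class \<chi> b c p"
proof -
  interpret ideal "H_ideal \<chi> b c" ring_of_type_algebra by (rule H_ideal_ideal)
  show "q \<in> H_class \<chi> b c p \<Longrightarrow> H_class \<chi> b c q = H_class \<chi> b c p"
    unfolding H_class_def by (rule a_repr_independence'[symmetric]) simp_all
qed

lemma H_class_relator:
  assumes "p - q \<in> H_relators \<chi> b c"
  shows "H_class \<chi> b c p = H_class \<chi> b c q"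
proof -
  have "p - q \<in> H_ideal \<chi> b c"
    using ring.genideal_self[OF ring_of_type_algebra_ring, of "H_relators \<chi> b c"] assms
    by (auto simp: H_ideal_def)
  then show ?thesis
    using ring.quotient_eq_iff_same_a_r_cos[OF ring_of_type_algebra_ring H_ideal_ideal, of p q]
    by (simp add: H_class_def)
qed

end

lemma poly_mapping_sum_single:
  "p = (\<Sum>w\<in>Poly_Mapping.keys p. Poly_Mapping.single w (Poly_Mapping.lookup p w))"
proof (rule poly_mapping_eqI)
  fix w
  have "(\<Sum>u\<in>Poly_Mapping.keys p. Poly_Mapping.lookup (Poly_Mapping.single u (Poly_Mapping.lookup p u)) w)
      = (\<Sum>u\<in>Poly_Mapping.keys p. if u = w then Poly_Mapping.lookup p w else 0)"
    by (rule sum.cong) (auto simp: lookup_single)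
  then show "Poly_Mapping.lookup p w
      = Poly_Mapping.lookup (\<Sum>w\<in>Poly_Mapping.keys p. Poly_Mapping.single w (Poly_Mapping.lookup p w)) w"
    by (simp add: lookup_sum in_keys_iff)
qed

lemma free_const_mult_single: "free_const a * Poly_Mapping.single w r = Poly_Mapping.single w (a * r)"
  by (simp add: free_const_def mult_single)

lemma free_const_commute:
  fixes p :: "('a, 'k::field) free_algebra"
  shows "free_const a * p = p * free_const a"
proof -
  have "free_const a * Poly_Mapping.single w r = Poly_Mapping.single w r * free_const a"
    for w :: "'a free_word" and r
    by (simp add: free_const_def mult_single mult.commute)
  then have "free_const a * (\<Sum>w\<in>Poly_Mapping.keys p. Poly_Mapping.single w (Poly_Mapping.lookup p w))
      = (\<Sum>w\<in>Poly_Mapping.keys p. Poly_Mapping.single w (Poly_Mapping.lookup p w)) * free_const a"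
    by (simp add: sum_distrib_left sum_distrib_right)
  then show ?thesis by (simp only: poly_mapping_sum_single[symmetric])
qed

text \<open>Pulling the action of \<open>H\<close> back to the free algebra replaces cosets by representatives.\<close>

definition H_act ::
    "('g::ab_group_add \<Rightarrow> 'k::field) \<Rightarrow> 'g \<Rightarrow> 'g \<Rightarrow> (('g generator, 'k) free_algebra set, 'm, 'z) module_scheme \<Rightarrow>
     ('g generator, 'k) free_algebra \<Rightarrow> 'm \<Rightarrow> 'm" where
  "H_act \<chi> b c M p m = H_class \<chi> b c p \<odot>\<^bsub>M\<^esub> m"

lemma H_act_algebra_action:
  assumes "left_module (H_alg \<chi> b c) M"
  shows "algebra_action M (H_act \<chi> b c M) free_const"
proof -
  interpret left_module "H_alg \<chi> b c" M by fact
  show ?thesis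
  proof
    show "free_const a * p = p * free_const a" for a :: 'b and p :: "('a generator, 'b) free_algebra"
      by (rule free_const_commute)
  qed (simp_all add: H_act_def H_class_hom_simps smult_closed smult_l_distr smult_r_distr
      smult_assoc smult_one free_const_def single_add mult_single)
qed

lemma H_act_relator:
  assumes "p - q \<in> H_relators \<chi> b c"
  shows "H_act \<chi> b c M p m = H_act \<chi> b c M q m"
  using H_class_relator[OF assms] by (simp add: H_act_def)

lemma H_act_H_representation:
  fixes \<chi> :: "'g::ab_group_add \<Rightarrow> 'k::{alg_closed_field, field_char_0}"
  assumes "left_module (H_alg \<chi> b c) M" "character \<chi>"
    and fd: "finite_dimensional (H_scalar \<chi> b c) M"
    and tf: "torsion_free_at (H_alg \<chi> b c) (H_x \<chi> b c) M"
  shows "H_representation M (H_act \<chi> b c M) free_const \<chi> b c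
    (\<lambda>g. free_gen (GenG g)) (free_gen GenX) (free_gen GenY)"
proof -
  interpret left_module "H_alg \<chi> b c" M by fact
  interpret algebra_action M "H_act \<chi> b c M" free_const
    by (rule H_act_algebra_action) fact
  let ?act = "H_act \<chi> b c M"
  note rel = H_act_relator[where M = M and \<chi> = \<chi> and b = b and c = c]
  show ?thesis
  proof
    show "\<exists>B. finite B \<and> B \<subseteq> carrier M \<and>
        (\<forall>m\<in>carrier M. \<exists>a. m = (\<Oplus>\<^bsub>M\<^esub>v\<in>B. ?act (free_const (a v)) v))"
      using fd by (simp add: finite_dimensional_def H_act_def H_scalar_def)
    show "character \<chi>" by fact
  next
    fix m assume m: "m \<in> carrier M"
    show "?act (free_gen (GenG 0)) m = m"
      using rel[OF grp_one] m by simp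
    show "?act (free_gen (GenG (g + h))) m = ?act (free_gen (GenG g)) (?act (free_gen (GenG h)) m)" for g h
      using rel[OF grp_mult] m by (simp add: act_mult)
    show "?act (free_gen GenX) (?act (free_gen (GenG g)) m)
      = ?act (free_const (\<chi> g)) (?act (free_gen (GenG g)) (?act (free_gen GenX) m))" for g
      using rel[OF x_grp, of g m] m by (simp add: act_mult)
    show "?act (free_gen GenY) (?act (free_gen (GenG g)) m)
      = ?act (free_const (inverse (\<chi> g))) (?act (free_gen (GenG g)) (?act (free_gen GenY) m))" for g
      using rel[OF y_grp, of g m] m by (simp add: act_mult)
    show "?act (free_gen GenY) (?act (free_gen GenX) m) = ?act (free_gen GenX) (?act (free_gen GenY) m)
      \<oplus>\<^bsub>M\<^esub> ?act (free_gen (GenG (- c)) - free_gen (GenG b)) m"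
      using rel[OF y_x, of m] m by (simp add: act_mult act_add)
    show "m = \<zero>\<^bsub>M\<^esub>" if "?act (free_gen GenX) m = \<zero>\<^bsub>M\<^esub>"
    proof (rule ccontr)
      assume "m \<noteq> \<zero>\<^bsub>M\<^esub>"
      then have "(H_x \<chi> b c [^]\<^bsub>H_alg \<chi> b c\<^esub> (1::nat)) \<odot>\<^bsub>M\<^esub> m \<noteq> \<zero>\<^bsub>M\<^esub>"
        using tf m unfolding torsion_free_at_def by blast
      moreover have "H_x \<chi> b c \<in> carrier (H_alg \<chi> b c)" by (simp add: H_x_def)
      ultimately show False using that by (simp add: H_act_def H_x_def)
    qed
  qed
qed

section \<open>The isomorphism with \<open>V\<^sub>x\<close>\<close>

text \<open>Every module axiom of \<open>N\<close> holds after applying the injection \<open>\<Phi>\<close> and so holds in \<open>N\<close>, which is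
  only assumed to be closed under its operations.\<close>

lemma isomorphic_left_modules_pullback:
  assumes M: "left_module R M" and bij: "bij_betw \<Phi> (carrier N) (carrier M)"
    and N_zero: "\<zero>\<^bsub>N\<^esub> \<in> carrier N" "\<Phi> \<zero>\<^bsub>N\<^esub> = \<zero>\<^bsub>M\<^esub>"
    and N_add: "\<And>u w. u \<in> carrier N \<Longrightarrow> w \<in> carrier N \<Longrightarrow> u \<oplus>\<^bsub>N\<^esub> w \<in> carrier N"
      "\<And>u w. u \<in> carrier N \<Longrightarrow> w \<in> carrier N \<Longrightarrow> \<Phi> (u \<oplus>\<^bsub>N\<^esub> w) = \<Phi> u \<oplus>\<^bsub>M\<^esub> \<Phi> w"
    and N_smult: "\<And>a u. a \<in> carrier R \<Longrightarrow> u \<in> carrier N \<Longrightarrow> a \<odot>\<^bsub>N\<^esub> u \<in> carrier N"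
      "\<And>a u. a \<in> carrier R \<Longrightarrow> u \<in> carrier N \<Longrightarrow> \<Phi> (a \<odot>\<^bsub>N\<^esub> u) = a \<odot>\<^bsub>M\<^esub> \<Phi> u"
  shows "isomorphic_left_modules R M N"
proof -
  interpret left_module R M by fact
  have inj: "\<Phi> u = \<Phi> w \<Longrightarrow> u = w" if "u \<in> carrier N" "w \<in> carrier N" for u w
    using bij that by (auto simp: bij_betw_def inj_on_def)
  have closed [simp]: "\<Phi> u \<in> carrier M" if "u \<in> carrier N" for u
    using bij that by (auto simp: bij_betw_def)
  have "abelian_group N"
  proof (rule abelian_groupI)
    fix u w z assume "u \<in> carrier N" "w \<in> carrier N" "z \<in> carrier N"
    then show "u \<oplus>\<^bsub>N\<^esub> w \<oplus>\<^bsub>N\<^esub> z = u \<oplus>\<^bsub>N\<^esub> (w \<oplus>\<^bsub>N\<^esub> z)"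
      by (intro inj) (simp_all add: N_add M.a_assoc)
  next
    fix u w assume "u \<in> carrier N" "w \<in> carrier N"
    then show "u \<oplus>\<^bsub>N\<^esub> w = w \<oplus>\<^bsub>N\<^esub> u"
      by (intro inj) (simp_all add: N_add M.a_comm)
  next
    fix u assume u: "u \<in> carrier N"
    then show "\<zero>\<^bsub>N\<^esub> \<oplus>\<^bsub>N\<^esub> u = u" by (intro inj) (simp_all add: N_add N_zero)
    obtain w where w: "w \<in> carrier N" "\<Phi> w = \<ominus>\<^bsub>M\<^esub> \<Phi> u"
      using bij u by (metis (no_types, lifting) M.a_inv_closed bij_betw_def closed imageE)
    then have "w \<oplus>\<^bsub>N\<^esub> u = \<zero>\<^bsub>N\<^esub>"
      using u by (intro inj) (simp_all add: N_add N_zero M.l_neg)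
    then show "\<exists>w\<in>carrier N. w \<oplus>\<^bsub>N\<^esub> u = \<zero>\<^bsub>N\<^esub>" using w by blast
  qed (fact N_add N_zero)+
  then interpret N: abelian_group N .
  have N: "left_module R N"
  proof
    fix a a' u w assume "a \<in> carrier R" "a' \<in> carrier R" "u \<in> carrier N" "w \<in> carrier N"
    note * = this
    from * show "(a \<oplus>\<^bsub>R\<^esub> a') \<odot>\<^bsub>N\<^esub> u = a \<odot>\<^bsub>N\<^esub> u \<oplus>\<^bsub>N\<^esub> a' \<odot>\<^bsub>N\<^esub> u"
      by (intro inj) (simp_all add: N_add N_smult smult_l_distr)
    from * show "a \<odot>\<^bsub>N\<^esub> (u \<oplus>\<^bsub>N\<^esub> w) = a \<odot>\<^bsub>N\<^esub> u \<oplus>\<^bsub>N\<^esub> a \<odot>\<^bsub>N\<^esub> w"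
      by (intro inj) (simp_all add: N_add N_smult smult_r_distr)
    from * show "(a \<otimes>\<^bsub>R\<^esub> a') \<odot>\<^bsub>N\<^esub> u = a \<odot>\<^bsub>N\<^esub> (a' \<odot>\<^bsub>N\<^esub> u)"
      by (intro inj) (simp_all add: N_smult smult_assoc)
  next
    fix u assume "u \<in> carrier N"
    then show "\<one>\<^bsub>R\<^esub> \<odot>\<^bsub>N\<^esub> u = u" by (intro inj) (simp_all add: N_smult smult_one)
  qed (fact N_smult)
  let ?\<phi> = "inv_into (carrier N) \<Phi>"
  have \<phi>: "?\<phi> m \<in> carrier N" "\<Phi> (?\<phi> m) = m" if "m \<in> carrier M" for m
    using bij that by (auto simp: bij_betw_def inv_into_into f_inv_into_f)
  have "?\<phi> (u \<oplus>\<^bsub>M\<^esub> w) = ?\<phi> u \<oplus>\<^bsub>N\<^esub> ?\<phi> w" if "u \<in> carrier M" "w \<in> carrier M" for u w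
    using that by (intro inj) (simp_all add: \<phi> N_add)
  moreover have "?\<phi> (a \<odot>\<^bsub>M\<^esub> u) = a \<odot>\<^bsub>N\<^esub> ?\<phi> u" if "a \<in> carrier R" "u \<in> carrier M" for a u
    using that by (intro inj) (simp_all add: \<phi> N_smult smult_closed)
  moreover have "bij_betw ?\<phi> (carrier M) (carrier N)" by (rule bij_betw_inv_into[OF bij])
  ultimately show ?thesis using M N unfolding isomorphic_left_modules_def by blast
qed

lemma Vx_on_basis_support:
  assumes "i < n" "n \<le> j"
  shows "Vx_on_basis \<chi> b c n \<rho> lam mu l i j = 0"
  using assms by (cases l) (auto simp: basis_vec_def)

lemma foldr_Vx_gen_support:
  assumes "n \<le> j" "f j = 0"
  shows "foldr (Vx_gen \<chi> b c n \<rho> lam mu) ls f j = 0"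
  using assms by (cases ls) (auto simp: Vx_gen_def Vx_on_basis_support)

lemma free_action_support:
  assumes "n \<le> j" "f j = 0"
  shows "free_action (Vx_gen \<chi> b c n \<rho> lam mu) p f j = 0"
  using assms by (simp add: free_action_def foldr_Vx_gen_support)

theorem proposition5p14:
  fixes \<chi> :: "'g::ab_group_add \<Rightarrow> 'k::{alg_closed_field, field_char_0}"
    and b c :: 'g
    and n :: nat
    and M :: "(('g generator, 'k) free_algebra set, 'm) module"
  assumes "finitely_generated_group TYPE('g)"
    and "character \<chi>"
    and "character_has_order \<chi> n"
    and "\<chi> b = \<chi> c"
    and "b + c \<noteq> 0"
    and "simple_left_module (H_alg \<chi> b c) M"
    and "finite_dimensional (H_scalar \<chi> b c) M"
    and "torsion_free_at (H_alg \<chi> b c) (H_x \<chi> b c) M"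
  shows "\<exists>\<rho> lam mu. character \<rho> \<and> lam \<noteq> 0 \<and>
           isomorphic_left_modules (H_alg \<chi> b c) M (V_x \<chi> b c n \<rho> lam mu)"
proof -
  have left: "left_module (H_alg \<chi> b c) M" and nonzero: "carrier M \<noteq> {\<zero>\<^bsub>M\<^esub>}"
    and simple: "\<And>N. submodule N (H_alg \<chi> b c) M \<Longrightarrow> N = {\<zero>\<^bsub>M\<^esub>} \<or> N = carrier M"
    using assms(6) by (auto simp: simple_left_module_def)
  let ?act = "H_act \<chi> b c M" and ?G = "\<lambda>g. free_gen (GenG g)"
    and ?x = "free_gen GenX" and ?y = "free_gen GenY"
  interpret H_representation M ?act free_const \<chi> b c ?G ?x ?y
    by (rule H_act_H_representation) fact+
  have "\<And>g. \<chi> g ^ n = 1" using assms(3) by (simp add: character_has_order_def)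
  from generating_vector_exists[OF assms(1) nonzero this] obtain \<rho> lam mu v where
    hv: "character \<rho>" "lam \<noteq> 0" "v \<in> weight_space \<rho>" "v \<noteq> \<zero>\<^bsub>M\<^esub>"
      "?act (?x ^ n) v = ?act (free_const lam) v" "?act (?x * ?y) v = ?act (free_const mu) v"
    by blast
  interpret H_generating_vector M ?act free_const \<chi> b c ?G ?x ?y n \<rho> lam mu v
    by unfold_locales (use assms(3) hv in auto)
  let ?V = "V_x \<chi> b c n \<rho> lam mu" and ?T = "Vx_gen \<chi> b c n \<rho> lam mu"
  define \<Phi> where "\<Phi> f = ?act (comb f) v" for f
  have gen: "gen l = free_gen l" for l by (cases l) (simp_all add: gen_def)

  \<comment> \<open>Compatibility of \<open>\<Phi>\<close> with the action passes from letters to words and then to the free algebra.\<close>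
  have word: "\<Phi> (foldr ?T ls f) = ?act (Poly_Mapping.single (Word ls) 1) (\<Phi> f)" for ls f
  proof (induction ls)
    case Nil
    have "Poly_Mapping.single (Word []) 1 = (1 :: ('g generator, 'k) free_algebra)"
      by (simp add: zero_free_word_def[symmetric])
    then show ?case by (simp add: \<Phi>_def)
  next
    case (Cons l ls)
    have "Poly_Mapping.single (Word (l # ls)) 1
        = free_gen l * (Poly_Mapping.single (Word ls) 1 :: ('g generator, 'k) free_algebra)"
      by (simp add: free_gen_def mult_single plus_free_word_def)
    moreover have "\<Phi> (foldr ?T (l # ls) f) = ?act (free_gen l) (\<Phi> (foldr ?T ls f))"
      by (simp add: \<Phi>_def comb_Vx_gen gen)
    ultimately show ?case using Cons by (simp add: act_mult \<Phi>_def)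
  qed
  have act: "\<Phi> (free_action ?T p f) = ?act p (\<Phi> f)" for p f
  proof -
    have "comb (free_action ?T p f) = (\<Sum>w\<in>Poly_Mapping.keys p.
        free_const (Poly_Mapping.lookup p w) * comb (foldr ?T (letters w) f))"
      unfolding free_action_def by (rule comb_linear)
    then have "\<Phi> (free_action ?T p f) = ?act (\<Sum>w\<in>Poly_Mapping.keys p.
        free_const (Poly_Mapping.lookup p w) * comb (foldr ?T (letters w) f)) v"
      by (simp add: \<Phi>_def)
    also have "\<dots> = ?act (\<Sum>w\<in>Poly_Mapping.keys p.
        Poly_Mapping.single w (Poly_Mapping.lookup p w) * comb f) v"
    proof (rule act_sum_cong)
      fix w
      have "Poly_Mapping.single w (Poly_Mapping.lookup p w)
          = free_const (Poly_Mapping.lookup p w) * Poly_Mapping.single w 1"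
        by (simp add: free_const_mult_single)
      then show "?act (free_const (Poly_Mapping.lookup p w) * comb (foldr ?T (letters w) f)) v
          = ?act (Poly_Mapping.single w (Poly_Mapping.lookup p w) * comb f) v"
        using word[of "letters w" f] by (simp add: act_mult \<Phi>_def)
    qed simp
    also have "\<dots> = ?act p (\<Phi> f)"
      unfolding sum_distrib_right[symmetric] poly_mapping_sum_single[symmetric]
      by (simp add: act_mult \<Phi>_def)
    finally show ?thesis .
  qed

  have carrier_V: "f \<in> carrier ?V \<longleftrightarrow> (\<forall>i\<ge>n. f i = 0)" for f by (simp add: V_x_def)
  have inj: "f = f'" if "f \<in> carrier ?V" "f' \<in> carrier ?V" "\<Phi> f = \<Phi> f'" for f f'
  proof
    fix i
    show "f i = f' i"
      using comb_injective[of f f' i] that by (cases "i < n") (simp_all add: \<Phi>_def carrier_V)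
  qed
  have action_V: "free_action ?T p f \<in> carrier ?V" if "f \<in> carrier ?V" for p f
    using that by (simp add: carrier_V free_action_support)
  \<comment> \<open>By injectivity of \<open>\<Phi>\<close>, all representatives of a class act alike on \<open>V\<^sub>x\<close>, since they do on \<open>M\<close>.\<close>
  have smult: "H_class \<chi> b c p \<odot>\<^bsub>?V\<^esub> f = free_action ?T p f" if f: "f \<in> carrier ?V" for p f
  proof -
    have same: "free_action ?T q f = free_action ?T p f" if "q \<in> H_class \<chi> b c p" for q
      using f action_V H_class_eqI[OF that] by (intro inj) (simp_all add: act H_act_def)
    have "H_class \<chi> b c p \<odot>\<^bsub>?V\<^esub> f = (THE w. \<forall>q\<in>H_class \<chi> b c p. free_action ?T q f = w)"
      by (simp add: V_x_def)
    also have "\<dots> = free_action ?T p f"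
    proof (rule the_equality)
      show "\<forall>q\<in>H_class \<chi> b c p. free_action ?T q f = free_action ?T p f" using same by blast
      show "w = free_action ?T p f" if "\<forall>q\<in>H_class \<chi> b c p. free_action ?T q f = w" for w
        using that H_class_self[of p \<chi> b c] by metis
    qed
    finally show ?thesis .
  qed
  have add: "\<Phi> (\<lambda>i. f i + f' i) = \<Phi> f \<oplus>\<^bsub>M\<^esub> \<Phi> f'" for f f'
    by (simp add: \<Phi>_def comb_def const_add distrib_right sum.distrib act_add)
  have zero: "\<Phi> (\<lambda>_. 0) = \<zero>\<^bsub>M\<^esub>" by (simp add: \<Phi>_def comb_def)

  \<comment> \<open>The image of \<open>\<Phi>\<close> is a submodule that contains \<open>v\<close>, hence all of \<open>M\<close>.\<close>
  have "submodule (\<Phi> ` carrier ?V) (H_alg \<chi> b c) M"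
  proof (intro submodule.intro submodule_axioms.intro)
    show "subgroup (\<Phi> ` carrier ?V) (add_monoid M)"
    proof (rule add.subgroupI)
      show "\<Phi> ` carrier ?V \<subseteq> carrier M" by (auto simp: \<Phi>_def)
      show "\<Phi> ` carrier ?V \<noteq> {}" by (auto simp: V_x_def)
    next
      fix m assume "m \<in> \<Phi> ` carrier ?V"
      then obtain f where f: "f \<in> carrier ?V" "m = \<Phi> f" by blast
      have "\<Phi> (\<lambda>i. - f i) \<oplus>\<^bsub>M\<^esub> \<Phi> f = \<zero>\<^bsub>M\<^esub>" using add[of "\<lambda>i. - f i" f] zero by simp
      then have "\<ominus>\<^bsub>M\<^esub> m = \<Phi> (\<lambda>i. - f i)"
        using f by (intro minus_equality) (simp_all add: \<Phi>_def)
      then show "\<ominus>\<^bsub>M\<^esub> m \<in> \<Phi> ` carrier ?V" using f by (auto simp: carrier_V)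
    next
      fix m m' assume "m \<in> \<Phi> ` carrier ?V" "m' \<in> \<Phi> ` carrier ?V"
      then obtain f f' where "f \<in> carrier ?V" "m = \<Phi> f" "f' \<in> carrier ?V" "m' = \<Phi> f'" by blast
      then show "m \<oplus>\<^bsub>M\<^esub> m' \<in> \<Phi> ` carrier ?V"
        by (auto simp: carrier_V add[symmetric])
    qed
    fix h m assume "h \<in> carrier (H_alg \<chi> b c)" "m \<in> \<Phi> ` carrier ?V"
    then obtain p f where "h = H_class \<chi> b c p" "f \<in> carrier ?V" "m = \<Phi> f"
      by (auto simp: carrier_H_alg)
    then show "h \<odot>\<^bsub>M\<^esub> m \<in> \<Phi> ` carrier ?V"
      using act[of p f] action_V[of f p] by (metis H_act_def imageI)
  qed
  moreover have "v \<in> \<Phi> ` carrier ?V"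
  proof
    show "v = \<Phi> (basis_vec 0)" using n_pos by (simp add: \<Phi>_def comb_basis_vec)
    show "basis_vec 0 \<in> carrier ?V" using n_pos by (simp add: carrier_V basis_vec_def)
  qed
  ultimately have "\<Phi> ` carrier ?V = carrier M" using simple hv(4) by blast
  then have "bij_betw \<Phi> (carrier ?V) (carrier M)"
    using inj by (auto simp: bij_betw_def inj_on_def)
  then have "isomorphic_left_modules (H_alg \<chi> b c) M ?V"
  proof (rule isomorphic_left_modules_pullback[OF left])
    show "\<zero>\<^bsub>?V\<^esub> \<in> carrier ?V" "\<Phi> \<zero>\<^bsub>?V\<^esub> = \<zero>\<^bsub>M\<^esub>" using zero by (simp_all add: V_x_def)
    show "u \<oplus>\<^bsub>?V\<^esub> w \<in> carrier ?V" if "u \<in> carrier ?V" "w \<in> carrier ?V" for u w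
      using that by (simp add: V_x_def)
    show "\<Phi> (u \<oplus>\<^bsub>?V\<^esub> w) = \<Phi> u \<oplus>\<^bsub>M\<^esub> \<Phi> w" for u w
      using add by (simp add: V_x_def)
    show "h \<odot>\<^bsub>?V\<^esub> u \<in> carrier ?V" if "h \<in> carrier (H_alg \<chi> b c)" "u \<in> carrier ?V" for h u
      using that smult action_V by (auto simp: carrier_H_alg)
    show "\<Phi> (h \<odot>\<^bsub>?V\<^esub> u) = h \<odot>\<^bsub>M\<^esub> \<Phi> u" if "h \<in> carrier (H_alg \<chi> b c)" "u \<in> carrier ?V" for h u
      using that smult act by (auto simp: carrier_H_alg H_act_def)
  qed
  with hv(1,2) show ?thesis by blast
qed

end
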